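(* Let $x_1,\ldots,x_n\in\Sigma$ and let $\Psi\in\mathcal H=\mathcal H_{AL}\otimes\mathcal F_-$ be an $n$-fermion state with fermions at the positions $x_1,\ldots,x_n$, i.e. $\Psi\in\mathcal H_{AL}\otimes\operatorname{span}\{\Phi_{A_1\ldots A_n}: A_1,\ldots,A_n\in\{1,2\}\}$, where $$\Phi_{A_1\ldots A_n}=\prod_{i=1}^n\theta^\dagger_{A_i}(x_i)\,|0\rangle\in\mathcal F_- .$$ Suppose $\Psi$ is gauge invariant, i.e. $U_g\Psi=\Psi$ for every gauge transformation $g$. Then the reduced density matrix $\rho^{\mathcal F_-}:=\operatorname{tr}_G(|\Psi\rangle\langle\Psi|)$ is maximally mixed on the subspace spanned by the $n$ fermions, i.e. $$\rho^{\mathcal F_-}=C\sum_{A_1,\ldots,A_n}|\Phi_{A_1\ldots A_n}\rangle\langle\Phi_{A_1\ldots A_n}|$$ for some constant $C$.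
   Context: $\Sigma$ is a 3-dimensional (analytic) manifold. Gravitational Hilbert space: $\mathcal H_{AL}=L^2(\overline{\mathcal A},d\mu_{AL})$ is the Ashtekar–Lewandowski Hilbert space for $SU(2)$ connections on $\Sigma$. It is the completion of the space of cylindrical functions $\psi(h_{e_1},\ldots,h_{e_m})$ of holonomies $h_e\in SU(2)$ along the edges $e$ of finite embedded graphs in $\Sigma$, where on each graph with $m$ edges the inner product is that of $L^2(SU(2)^m)$ with normalized Haar measure. An edge $e$ has source $s(e)$ and target $t(e)$. Fermionic Hilbert space: $\mathcal F_-$ is the fermionic (antisymmetric) Fock space over the one-particle space $\ell^2(\Sigma,\mathbb C^2)$, the completion of the finitely supported functions $f:\Sigma\to\mathbb C^2$ with $\langle f,f'\rangle=\sum_{x\in\Sigma}\overline{f(x)}\cdot f'(x)$. Annihilation operators $\theta_A(x)$ and their adjoints, the creation operators $\theta_A^\dagger(x)$ ($x\in\Sigma$, $A\in\{1,2\}$), satisfy $\theta_A(x)\theta_B^\dagger(y)+\theta_B^\dagger(y)\theta_A(x)=\delta_{x,y}\delta_{AB}$, all other anticommutators being zero, and $\theta_A(x)|0\rangle=0$. The total Hilbert space is $\mathcal H=\mathcal H_{AL}\otimes\mathcal F_-$. Gauge transformations: these are arbitrary maps $g:\Sigma\to SU(2)$. They act on $\mathcal H$ by unitaries $U_g$, tensor products of unitaries on the two factors. On $\mathcal H_{AL}$, $U_g$ is induced by $h_e\mapsto g(t(e))\,h_e\,g(s(e))^{-1}$. On $\mathcal F_-$, $U_g|0\rangle=|0\rangle$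 and $U_g\theta_A(x)U_g^{-1}=\sum_B g(x)_{AB}\,\theta_B(x)$. Gravitational trace: $\operatorname{tr}_G(\cdot)=\sum_{S}\langle S|\cdot|S\rangle$, where $S$ runs over the orthonormal basis of $\mathcal H_{AL}$ given by generalized (not necessarily gauge invariant) spin networks; i.e. $\operatorname{tr}_G$ is the partial trace over $\mathcal H_{AL}$, mapping pure density matrices over $\mathcal H$ to density matrices over $\mathcal F_-$. *)

theory Defs
  imports "HOL-Probability.Probability"
begin

section \<open>Analytic 3-manifolds, edges and graphs\<close>

definition real_analytic_on :: "(real^'n \<Rightarrow> real^'m) \<Rightarrow> (real^'n) set \<Rightarrow> bool" where
  "real_analytic_on f S \<longleftrightarrow>
     (\<forall>a\<in>S. \<exists>r>0. \<exists>c :: ('n \<Rightarrow> nat) \<Rightarrow> real^'m. \<forall>x\<in>ball a r.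
        ((\<lambda>\<alpha>. (\<Prod>i\<in>UNIV. (x $ i - a $ i) ^ \<alpha> i) *\<^sub>R c \<alpha>) has_sum f x) UNIV)"

definition analytic_atlas ::
    "('p::{t2_space,second_countable_topology} set \<times> ('p \<Rightarrow> real^3)) set \<Rightarrow> bool" where
  "analytic_atlas \<A> \<longleftrightarrow>
     (\<Union>(U, c)\<in>\<A>. U) = UNIV \<and>
     (\<forall>(U, c)\<in>\<A>. open U \<and> open (c ` U) \<and> homeomorphism U (c ` U) c (inv_into U c)) \<and>
     (\<forall>(U, c)\<in>\<A>. \<forall>(V, d)\<in>\<A>. real_analytic_on (d \<circ> inv_into U c) (c ` (U \<inter> V)))"

type_synonym 'p atlas = "('p set \<times> ('p \<Rightarrow> real^3)) set"
type_synonym 'p curve = "real \<Rightarrow> 'p"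

text \<open>
  An edge is an embedded analytic curve with non-vanishing velocity, parametrized by the unit
  interval; at the end points the power series are one-sided, so that the curve extends
  analytically beyond them. The source of \<open>e\<close> is \<^term>\<open>pathstart e\<close>, the target is
  \<^term>\<open>pathfinish e\<close>. Closed loops occur as composites of edges.
\<close>
definition edges :: "'p::topological_space atlas \<Rightarrow> 'p curve set" where
  "edges \<A> = {e. arc e \<and>
     (\<forall>(U, c)\<in>\<A>. \<forall>t\<in>{0..1}. e t \<in> U \<longrightarrow>
        (\<exists>r>0. \<exists>a :: nat \<Rightarrow> real^3. a 1 \<noteq> 0 \<and>
           (\<forall>s\<in>{0..1}. \<bar>s - t\<bar> < r \<longrightarrow> e s \<in> U \<and> (\<lambda>k. (s - t) ^ k *\<^sub>R a k) sums c (e s))))}"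

definition is_graph :: "'p::topological_space atlas \<Rightarrow> 'p curve set \<Rightarrow> bool" where
  "is_graph \<A> \<gamma> \<longleftrightarrow> finite \<gamma> \<and> \<gamma> \<subseteq> edges \<A> \<and>
     (\<forall>e\<in>\<gamma>. \<forall>e'\<in>\<gamma>. e \<noteq> e' \<longrightarrow>
        path_image e \<inter> path_image e' \<subseteq> {pathstart e, pathfinish e} \<inter> {pathstart e', pathfinish e'})"


section \<open>\<open>SU(2)\<close>, generalized connections and the Ashtekar--Lewandowski measure\<close>

definition adj :: "complex^'n^'n \<Rightarrow> complex^'n^'n" where
  "adj U = (\<chi> i j. cnj (U $ j $ i))"

definition SU2 :: "(complex^2^2) set" where
  "SU2 = {U. U ** adj U = mat 1 \<and> det U = 1}"

definition is_haar_SU2 :: "(complex^2^2) measure \<Rightarrow> bool" where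
  "is_haar_SU2 \<eta> \<longleftrightarrow> sets \<eta> = sets (restrict_space borel SU2) \<and> prob_space \<eta> \<and>
     (\<forall>g\<in>SU2. distr \<eta> \<eta> (\<lambda>h. g ** h) = \<eta> \<and> distr \<eta> \<eta> (\<lambda>h. h ** g) = \<eta>)"

type_synonym 'p conn = "'p curve \<Rightarrow> complex^2^2"

text \<open>
  A generalized connection is a homomorphism from the groupoid of piecewise analytic paths (modulo
  orientation preserving reparametrization and retracings) to \<open>SU(2)\<close>. Since that groupoid is
  generated by the edges, such a homomorphism is recorded by its values \<open>A e\<close> on edges, the
  holonomies. Composition is in the order dictated by \<open>h\<^sub>e \<mapsto> g (t e) h\<^sub>e (g (s e))\<^sup>-\<^sup>1\<close>: the part
  traversed first stands on the right. Outside the edges \<open>A\<close> is \<open>undefined\<close>.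
\<close>
definition gen_conns :: "'p::topological_space atlas \<Rightarrow> 'p conn set" where
  "gen_conns \<A> = {A. A \<in> edges \<A> \<rightarrow>\<^sub>E SU2 \<and>
     (\<forall>e\<in>edges \<A>. \<forall>e'\<in>edges \<A>. \<forall>\<phi>.
        continuous_on {0..1} \<phi> \<and> strict_mono_on {0..1} \<phi> \<and> \<phi> 0 = 0 \<and> \<phi> 1 = 1 \<and>
        (\<forall>s\<in>{0..1}. e' s = e (\<phi> s)) \<longrightarrow> A e' = A e) \<and>
     (\<forall>e\<in>edges \<A>. A (reversepath e) = matrix_inv (A e)) \<and>
     (\<forall>e\<in>edges \<A>. \<forall>\<tau>\<in>{0<..<1}.
        A e = A (\<lambda>s. e (\<tau> + (1 - \<tau>) * s)) ** A (\<lambda>s. e (\<tau> * s)))}"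

text \<open>
  The \<open>\<sigma>\<close>-algebra is the one generated by the holonomies, i.e. by the cylindrical functions. The
  clause on graphs says that the inner product of cylindrical functions \<open>\<psi>(h\<^sub>e : e \<in> \<gamma>)\<close> is that of
  the product Haar measure on \<open>SU(2)\<^sup>\<gamma>\<close>.
\<close>
definition haar_marginals ::
    "'p::topological_space atlas \<Rightarrow> (complex^2^2) measure \<Rightarrow> 'p conn measure \<Rightarrow> bool" where
  "haar_marginals \<A> \<eta> \<mu> \<longleftrightarrow>
     space \<mu> = gen_conns \<A> \<and>
     sets \<mu> = sets (restrict_space (PiM (edges \<A>) (\<lambda>_. borel)) (gen_conns \<A>)) \<and>
     prob_space \<mu> \<and>
     (\<forall>\<gamma>. is_graph \<A> \<gamma> \<longrightarrow>
        distr \<mu> (PiM \<gamma> (\<lambda>_. \<eta>)) (\<lambda>A. restrict A \<gamma>) = PiM \<gamma> (\<lambda>_. \<eta>))"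

text \<open>The Ashtekar--Lewandowski measure is \<^emph>\<open>the\<close> measure with these marginals.\<close>
definition is_AL_measure ::
    "'p::topological_space atlas \<Rightarrow> (complex^2^2) measure \<Rightarrow> 'p conn measure \<Rightarrow> bool" where
  "is_AL_measure \<A> \<eta> \<mu> \<longleftrightarrow>
     haar_marginals \<A> \<eta> \<mu> \<and> (\<forall>\<nu>. haar_marginals \<A> \<eta> \<nu> \<longrightarrow> \<nu> = \<mu>)"


section \<open>The gravitational Hilbert space\<close>

text \<open>
  Elements of \<open>L\<^sup>2\<close> spaces are represented by functions; two functions that agree almost everywhere
  represent the same element.
\<close>
definition L2 :: "'a measure \<Rightarrow> ('a \<Rightarrow> complex) set" where
  "L2 \<mu> = {f \<in> borel_measurable \<mu>. integrable \<mu> (\<lambda>A. (cmod (f A))\<^sup>2)}"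

definition L2_inner :: "'a measure \<Rightarrow> ('a \<Rightarrow> complex) \<Rightarrow> ('a \<Rightarrow> complex) \<Rightarrow> complex" where
  "L2_inner \<mu> f f' = (\<integral>A. cnj (f A) * f' A \<partial>\<mu>)"

definition L2_onb :: "'a measure \<Rightarrow> ('a \<Rightarrow> complex) set \<Rightarrow> bool" where
  "L2_onb \<mu> B \<longleftrightarrow> B \<subseteq> L2 \<mu> \<and>
     (\<forall>S\<in>B. \<forall>S'\<in>B. L2_inner \<mu> S S' = (if S = S' then 1 else 0)) \<and>
     (\<forall>f\<in>L2 \<mu>. \<forall>\<epsilon>>0. \<exists>F c. finite F \<and> F \<subseteq> B \<and>
        (\<integral>A. (cmod (f A - (\<Sum>S\<in>F. c S * S A)))\<^sup>2 \<partial>\<mu>) < \<epsilon>)"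

definition gauge_transf :: "('p \<Rightarrow> complex^2^2) \<Rightarrow> bool" where
  "gauge_transf g \<longleftrightarrow> range g \<subseteq> SU2"

definition gauge_conn ::
    "'p::topological_space atlas \<Rightarrow> ('p \<Rightarrow> complex^2^2) \<Rightarrow> 'p conn \<Rightarrow> 'p conn" where
  "gauge_conn \<A> g A =
     (\<lambda>e\<in>edges \<A>. g (pathfinish e) ** A e ** matrix_inv (g (pathstart e)))"

definition gauge_AL ::
    "'p::topological_space atlas \<Rightarrow> ('p \<Rightarrow> complex^2^2) \<Rightarrow> ('p conn \<Rightarrow> complex) \<Rightarrow> 'p conn \<Rightarrow> complex" where
  "gauge_AL \<A> g f = (\<lambda>A. f (gauge_conn \<A> g A))"


section \<open>The fermionic Fock space\<close>

text \<open>
  The one-particle space is \<open>\<ell>\<^sup>2(\<Sigma> \<times> {1,2})\<close>, with the spinor index in the two-element type \<open>2\<close>. Its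
  \<open>n\<close>-fold tensor power is \<open>\<ell>\<^sup>2\<close> of the lists of length \<open>n\<close>, so the full Fock space is \<open>\<ell>\<^sup>2\<close> of the
  set of all lists, and \<open>\<F>\<^sub>-\<close> is its subspace of antisymmetric wave functions.
\<close>
type_synonym 'p config = "('p \<times> 2) list"

definition swap_list :: "'b list \<Rightarrow> nat \<Rightarrow> nat \<Rightarrow> 'b list" where
  "swap_list l i j = l[i := l ! j, j := l ! i]"

definition Fock :: "('p config \<Rightarrow> complex) set" where
  "Fock = {\<phi>. (\<forall>l i j. i < j \<and> j < length l \<longrightarrow> \<phi> (swap_list l i j) = - \<phi> l) \<and>
              (\<lambda>l. (cmod (\<phi> l))\<^sup>2) summable_on UNIV}"

definition Fock_inner :: "('p config \<Rightarrow> complex) \<Rightarrow> ('p config \<Rightarrow> complex) \<Rightarrow> complex" where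
  "Fock_inner \<phi> \<phi>' = (\<Sum>\<^sub>\<infinity>l. cnj (\<phi> l) * \<phi>' l)"

definition vac :: "'p config \<Rightarrow> complex" where
  "vac l = (if l = [] then 1 else 0)"

definition annih :: "2 \<Rightarrow> 'p \<Rightarrow> ('p config \<Rightarrow> complex) \<Rightarrow> 'p config \<Rightarrow> complex" where
  "annih A x \<phi> = (\<lambda>l. complex_of_real (sqrt (real (length l) + 1)) * \<phi> ((x, A) # l))"

text \<open>The adjoint of \<^const>\<open>annih\<close>: it antisymmetrizes \<open>(x, A) \<otimes> \<phi>\<close>.\<close>
definition creat :: "2 \<Rightarrow> 'p \<Rightarrow> ('p config \<Rightarrow> complex) \<Rightarrow> 'p config \<Rightarrow> complex" where
  "creat A x \<phi> = (\<lambda>l. (\<Sum>i<length l. if l ! i = (x, A)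
       then (-1) ^ i * \<phi> (take i l @ drop (Suc i) l) else 0) / complex_of_real (sqrt (real (length l))))"

text \<open>
  The second quantization of \<open>e\<^bsub>x,A\<^esub> \<mapsto> \<Sum>\<^sub>B cnj (g(x)\<^sub>A\<^sub>B) e\<^bsub>x,B\<^esub>\<close>; see \<open>gauge_Fock_annih\<close> below.
\<close>
definition gauge_Fock ::
    "('p \<Rightarrow> complex^2^2) \<Rightarrow> ('p config \<Rightarrow> complex) \<Rightarrow> 'p config \<Rightarrow> complex" where
  "gauge_Fock g \<phi> = (\<lambda>l. \<Sum>Bs\<in>{Bs. length Bs = length l}.
       (\<Prod>i<length l. cnj (g (fst (l ! i)) $ (Bs ! i) $ snd (l ! i))) * \<phi> (zip (map fst l) Bs))"

lemma annih_vac: "annih A x vac = (\<lambda>l. 0)"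
  by (simp add: annih_def vac_def)

lemma finite_lists_length: "finite {Bs :: 2 list. length Bs = n}"
  using finite_lists_length_eq[of "UNIV :: 2 set" n] by simp

lemma gauge_Fock_vac: "gauge_Fock g vac = vac"
proof
  fix l :: "'a config"
  show "gauge_Fock g vac l = vac l"
  proof (cases l)
    case Nil
    then show ?thesis by (simp add: gauge_Fock_def vac_def)
  next
    case (Cons a l')
    have "zip (map fst l) Bs \<noteq> []" if "length Bs = length l" for Bs :: "2 list"
      using that Cons by (cases Bs) auto
    then show ?thesis using Cons by (simp add: gauge_Fock_def vac_def)
  qed
qed

lemma SU2_unitary:
  assumes "U \<in> SU2"
  shows "(\<Sum>B\<in>UNIV. U $ A $ B * cnj (U $ A' $ B)) = (if A = A' then 1 else 0)"
proof -
  have "(U ** adj U) $ A $ A' = (mat 1 :: complex^2^2) $ A $ A'"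
    using assms by (simp add: SU2_def)
  then show ?thesis by (simp add: matrix_matrix_mult_def adj_def mat_def)
qed

lemma gauge_Fock_Cons:
  "gauge_Fock g \<phi> ((x, B) # l) =
     (\<Sum>B'\<in>UNIV. cnj (g x $ B' $ B) *
        (\<Sum>Bs\<in>{Bs. length Bs = length l}.
           (\<Prod>i<length l. cnj (g (fst (l ! i)) $ (Bs ! i) $ snd (l ! i))) *
           \<phi> ((x, B') # zip (map fst l) Bs)))"
proof -
  have eq: "{Bs. length Bs = Suc (length l)} =
      (\<lambda>(b, Bs). b # Bs) ` (UNIV \<times> {Bs :: 2 list. length Bs = length l})"
    by (auto simp: length_Suc_conv image_iff)
  have inj: "inj_on (\<lambda>(b, Bs). b # Bs) (UNIV \<times> {Bs :: 2 list. length Bs = length l})"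
    by (auto simp: inj_on_def)
  show ?thesis
    unfolding gauge_Fock_def length_Cons eq sum.reindex[OF inj] prod.lessThan_Suc_shift
    by (simp add: sum.cartesian_product sum_distrib_left mult.assoc split_def)
qed

text \<open>\<open>U\<^sub>g \<theta>\<^sub>A(x) = (\<Sum>\<^sub>B g(x)\<^sub>A\<^sub>B \<theta>\<^sub>B(x)) U\<^sub>g\<close>\<close>
lemma gauge_Fock_annih:
  assumes "gauge_transf g"
  shows "gauge_Fock g (annih A x \<phi>) = (\<lambda>l. \<Sum>B\<in>UNIV. g x $ A $ B * annih B x (gauge_Fock g \<phi>) l)"
proof
  fix l
  have U: "g x \<in> SU2" using assms by (auto simp: gauge_transf_def)
  define T where "T B' = (\<Sum>Bs\<in>{Bs. length Bs = length l}.
           (\<Prod>i<length l. cnj (g (fst (l ! i)) $ (Bs ! i) $ snd (l ! i))) *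
           \<phi> ((x, B') # zip (map fst l) Bs))" for B'
  have Cons: "gauge_Fock g \<phi> ((x, B) # l) = (\<Sum>B'\<in>UNIV. cnj (g x $ B' $ B) * T B')" for B
    by (simp add: gauge_Fock_Cons T_def)
  have "(\<Sum>B\<in>UNIV. g x $ A $ B * annih B x (gauge_Fock g \<phi>) l) =
      complex_of_real (sqrt (real (length l) + 1)) *
      (\<Sum>B\<in>UNIV. \<Sum>B'\<in>UNIV. g x $ A $ B * cnj (g x $ B' $ B) * T B')"
    by (simp add: annih_def Cons sum_distrib_left mult_ac)
  also have "(\<Sum>B\<in>UNIV. \<Sum>B'\<in>UNIV. g x $ A $ B * cnj (g x $ B' $ B) * T B') =
      (\<Sum>B'\<in>UNIV. (\<Sum>B\<in>UNIV. g x $ A $ B * cnj (g x $ B' $ B)) * T B')"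
    by (subst sum.swap) (simp add: sum_distrib_right)
  also have "\<dots> = T A"
    by (simp add: SU2_unitary[OF U] if_distrib[of "\<lambda>c. c * _"] cong: if_cong)
  also have "complex_of_real (sqrt (real (length l) + 1)) * T A = gauge_Fock g (annih A x \<phi>) l"
    by (simp add: T_def gauge_Fock_def annih_def sum_distrib_left mult_ac)
  finally show "gauge_Fock g (annih A x \<phi>) l = (\<Sum>B\<in>UNIV. g x $ A $ B * annih B x (gauge_Fock g \<phi>) l)" ..
qed

lemma anticommutator:
  "(\<lambda>l. annih A x (creat B y \<phi>) l + creat B y (annih A x \<phi>) l) =
   (\<lambda>l. if x = y \<and> A = B then \<phi> l else 0)"
proof
  fix l :: "('a \<times> 2) list"
  define n where "n = length l"
  define c where "c = complex_of_real (sqrt (real n + 1))"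
  define S where "S = (\<Sum>i<n. if l ! i = (y, B)
       then (-1) ^ i * \<phi> ((x, A) # take i l @ drop (Suc i) l) else 0)"
  have c0: "c \<noteq> 0"
    unfolding c_def by (simp del: of_real_sqrt)
  have "annih A x (creat B y \<phi>) l =
      c * ((if x = y \<and> A = B then \<phi> l else 0) - S) / c"
    unfolding annih_def creat_def length_Cons n_def[symmetric] sum.lessThan_Suc_shift S_def c_def
    by (simp add: sum_negf[symmetric] add.commute if_distrib[of uminus] cong: if_cong)
  moreover have "creat B y (annih A x \<phi>) l = S"
  proof (cases "n = 0")
    case True
    then show ?thesis by (simp add: creat_def S_def n_def)
  next
    case False
    have *: "real (length (take i l @ drop (Suc i) l)) + 1 = real n" if "i < n" for i
      using that by (auto simp: n_def min_def)
    have "creat B y (annih A x \<phi>) l =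
       (\<Sum>i<n. complex_of_real (sqrt (real n)) * (if l ! i = (y, B)
       then (-1) ^ i * \<phi> ((x, A) # take i l @ drop (Suc i) l) else 0)) / complex_of_real (sqrt (real n))"
      unfolding creat_def annih_def n_def[symmetric]
      by (intro arg_cong2[where f="(/)"] sum.cong refl) (auto simp only: * lessThan_iff mult_zero_right mult_zero_left mult_ac split: if_splits)
    then show ?thesis using False unfolding S_def sum_distrib_left[symmetric] by simp
  qed
  ultimately show "annih A x (creat B y \<phi>) l + creat B y (annih A x \<phi>) l =
      (if x = y \<and> A = B then \<phi> l else 0)"
    using c0 by simp
qed

definition Phi :: "'p list \<Rightarrow> 2 list \<Rightarrow> 'p config \<Rightarrow> complex" where
  "Phi xs As = foldr (\<lambda>(x, A). creat A x) (zip xs As) vac"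


section \<open>The total Hilbert space and the partial trace\<close>

text \<open>
  \<open>\<H>\<^sub>A\<^sub>L \<otimes> \<F>\<^sub>-\<close> is realized as the space of antisymmetric, square summable families in \<open>\<H>\<^sub>A\<^sub>L\<close> indexed by
  the lists, with \<open>f \<otimes> \<phi> = (\<phi>(l) f)\<^sub>l\<close>.
\<close>
type_synonym 'p state = "'p conn \<Rightarrow> 'p config \<Rightarrow> complex"

definition Htot :: "'p conn measure \<Rightarrow> 'p state set" where
  "Htot \<mu> = {\<Psi>. (\<forall>l. (\<lambda>A. \<Psi> A l) \<in> L2 \<mu>) \<and>
     (\<forall>l i j. i < j \<and> j < length l \<longrightarrow> (AE A in \<mu>. \<Psi> A (swap_list l i j) = - \<Psi> A l)) \<and>
     (\<lambda>l. \<integral>A. (cmod (\<Psi> A l))\<^sup>2 \<partial>\<mu>) summable_on UNIV}"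

definition Htot_inner :: "'p conn measure \<Rightarrow> 'p state \<Rightarrow> 'p state \<Rightarrow> complex" where
  "Htot_inner \<mu> \<Psi> \<Psi>' = (\<Sum>\<^sub>\<infinity>l. L2_inner \<mu> (\<lambda>A. \<Psi> A l) (\<lambda>A. \<Psi>' A l))"

definition Htot_eq :: "'p conn measure \<Rightarrow> 'p state \<Rightarrow> 'p state \<Rightarrow> bool" where
  "Htot_eq \<mu> \<Psi> \<Psi>' \<longleftrightarrow> (\<forall>l. AE A in \<mu>. \<Psi> A l = \<Psi>' A l)"

definition tensor :: "('p conn \<Rightarrow> complex) \<Rightarrow> ('p config \<Rightarrow> complex) \<Rightarrow> 'p state" where
  "tensor f \<phi> = (\<lambda>A l. f A * \<phi> l)"

text \<open>The tensor product of \<^const>\<open>gauge_AL\<close> and \<^const>\<open>gauge_Fock\<close>.\<close>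
definition gauge_tot ::
    "'p::topological_space atlas \<Rightarrow> ('p \<Rightarrow> complex^2^2) \<Rightarrow> 'p state \<Rightarrow> 'p state" where
  "gauge_tot \<A> g \<Psi> = (\<lambda>A. gauge_Fock g (\<Psi> (gauge_conn \<A> g A)))"

lemma gauge_tot_tensor:
  "gauge_tot \<A> g (tensor f \<phi>) = tensor (gauge_AL \<A> g f) (gauge_Fock g \<phi>)"
  by (simp add: gauge_tot_def tensor_def gauge_AL_def gauge_Fock_def sum_distrib_left mult_ac)

definition gauge_invariant ::
    "'p::topological_space atlas \<Rightarrow> 'p conn measure \<Rightarrow> 'p state \<Rightarrow> bool" where
  "gauge_invariant \<A> \<mu> \<Psi> \<longleftrightarrow> (\<forall>g. gauge_transf g \<longrightarrow> Htot_eq \<mu> (gauge_tot \<A> g \<Psi>) \<Psi>)"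

text \<open>\<open>\<H>\<^sub>A\<^sub>L \<otimes> span {\<Phi>\<^bsub>A\<^sub>1\<dots>A\<^sub>n\<^esub>}\<close>\<close>
definition fermions_at :: "'p conn measure \<Rightarrow> 'p list \<Rightarrow> 'p state set" where
  "fermions_at \<mu> xs = {\<Psi> \<in> Htot \<mu>. \<exists>f. (\<forall>As. length As = length xs \<longrightarrow> f As \<in> L2 \<mu>) \<and>
     Htot_eq \<mu> \<Psi> (\<lambda>A l. \<Sum>As\<in>{As. length As = length xs}. tensor (f As) (Phi xs As) A l)}"

definition ketbra_tot :: "'p conn measure \<Rightarrow> 'p state \<Rightarrow> 'p state \<Rightarrow> 'p state" where
  "ketbra_tot \<mu> \<Psi> = (\<lambda>\<xi> A l. \<Psi> A l * Htot_inner \<mu> \<Psi> \<xi>)"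

definition ketbra_Fock ::
    "('p config \<Rightarrow> complex) \<Rightarrow> ('p config \<Rightarrow> complex) \<Rightarrow> 'p config \<Rightarrow> complex" where
  "ketbra_Fock \<phi> = (\<lambda>\<xi> l. \<phi> l * Fock_inner \<phi> \<xi>)"

definition braS :: "'p conn measure \<Rightarrow> ('p conn \<Rightarrow> complex) \<Rightarrow> 'p state \<Rightarrow> 'p config \<Rightarrow> complex" where
  "braS \<mu> S \<Psi> = (\<lambda>l. L2_inner \<mu> S (\<lambda>A. \<Psi> A l))"

text \<open>
  The operator \<open>\<Sum>\<^sub>S \<langle>S| T |S\<rangle>\<close> on \<open>\<F>\<^sub>-\<close>, where \<open>S\<close> runs over an orthonormal basis \<open>B\<close> of \<open>\<H>\<^sub>A\<^sub>L\<close> and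
  \<open>|S\<rangle> : \<phi> \<mapsto> S \<otimes> \<phi>\<close>.
\<close>
definition tr_G ::
    "'p conn measure \<Rightarrow> ('p conn \<Rightarrow> complex) set \<Rightarrow> ('p state \<Rightarrow> 'p state) \<Rightarrow>
     ('p config \<Rightarrow> complex) \<Rightarrow> 'p config \<Rightarrow> complex" where
  "tr_G \<mu> B T = (\<lambda>\<phi> l. \<Sum>\<^sub>\<infinity>S\<in>B. braS \<mu> S (T (tensor S \<phi>)) l)"

end

theory Submission
  imports Defs
begin

text \<open>
  The matrix elements of \<open>\<rho>\<close> are \<open>K(l, m) = \<langle>\<Psi>\<^sub>m, \<Psi>\<^sub>l\<rangle>\<close>, by Parseval. Gauge transformations preserve the
  Ashtekar--Lewandowski measure, because translations preserve Haar measure and the measure is unique;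
  so gauge invariance of \<open>\<Psi>\<close> makes \<open>K\<close> commute with the gauge group acting on the spins. Two
  elements of \<open>SU(2)\<close> at each point already suffice in place of Schur's lemma: \<open>diag(i, -i)\<close> kills
  the matrix elements between different spin configurations, and the rotation that exchanges
  spin up and spin down makes all diagonal elements equal. Positions \<open>x\<^sub>i\<close> may coincide; then
  antisymmetry leaves only the singlet at a doubly occupied point. The kernel of
  \<open>\<Sum> |\<Phi>\<rangle>\<langle>\<Phi>|\<close> has the same symmetries, and a kernel with these symmetries is unique up to a factor.
\<close>

section \<open>Antisymmetric functions and the states \<open>\<Phi>\<close>\<close>

text \<open>Stated for neighbouring entries, which suits induction along lists; adjacent
  transpositions generate all permutations, so this is full antisymmetry.\<close>

definition antisymmetric :: "('b list \<Rightarrow> complex) \<Rightarrow> bool" where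
  "antisymmetric \<phi> \<longleftrightarrow> (\<forall>k a b l. \<phi> (k @ a # b # l) = - \<phi> (k @ b # a # l))"

lemma antisymmetricD: "antisymmetric \<phi> \<Longrightarrow> \<phi> (k @ a # b # l) = - \<phi> (k @ b # a # l)"
  unfolding antisymmetric_def by blast

lemma antisymmetric_Cons:
  assumes "antisymmetric \<phi>"
  shows "antisymmetric (\<lambda>l. \<phi> (a # l))"
  unfolding antisymmetric_def
proof (intro allI)
  fix k b c l
  show "\<phi> (a # k @ b # c # l) = - \<phi> (a # k @ c # b # l)"
    using antisymmetricD[OF assms, of "a # k" b c l] unfolding append_Cons .
qed

lemma antisymmetric_cmult: "antisymmetric \<phi> \<Longrightarrow> antisymmetric (\<lambda>l. c * \<phi> l)"
  unfolding antisymmetric_def mult_minus_right[symmetric] by metis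

lemma antisymmetric_sum:
  assumes "\<And>i. i \<in> I \<Longrightarrow> antisymmetric (\<phi> i)"
  shows "antisymmetric (\<lambda>l. \<Sum>i\<in>I. \<phi> i l)"
  unfolding antisymmetric_def sum_negf[symmetric]
  by (intro allI sum.cong refl antisymmetricD assms)

lemma antisymmetric_if_swap_list:
  fixes \<phi> :: "'b list \<Rightarrow> complex"
  assumes "\<And>l i j. i < j \<Longrightarrow> j < length l \<Longrightarrow> \<phi> (swap_list l i j) = - \<phi> l"
  shows "antisymmetric \<phi>"
  unfolding antisymmetric_def
proof (intro allI)
  fix k l :: "'b list" and a b
  have "swap_list (k @ b # a # l) (length k) (Suc (length k)) = k @ a # b # l"
    by (simp add: swap_list_def nth_append list_update_append)
  moreover have "\<phi> (swap_list (k @ b # a # l) (length k) (Suc (length k))) = - \<phi> (k @ b # a # l)"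
    by (rule assms) simp_all
  ultimately show "\<phi> (k @ a # b # l) = - \<phi> (k @ b # a # l)" by (simp only:)
qed

lemma antisymmetric_move:
  "antisymmetric \<phi> \<Longrightarrow> \<phi> (k @ a # l) = (- 1) ^ length k * \<phi> (a # k @ l)"
proof (induction k arbitrary: \<phi>)
  case (Cons b k)
  have "\<phi> ((b # k) @ a # l) = (- 1) ^ length k * \<phi> (b # a # k @ l)"
    using Cons.IH[OF antisymmetric_Cons[OF Cons.prems, of b]] by simp
  also have "\<phi> (b # a # k @ l) = - \<phi> (a # b # k @ l)"
    using antisymmetricD[OF Cons.prems, of "[]" b a] unfolding append_Nil .
  finally show ?case by simp
qed simp

text \<open>Each entry of \<open>l\<close> in turn is moved to the front of what remains of
  \<open>m\<close>. The sign is chosen before \<phi>, so one sign serves every antisymmetric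
  function; this is what allows different kernels, and the two arguments of one kernel, to be
  compared.\<close>

lemma antisymmetric_perm:
  "mset l = mset m \<Longrightarrow> \<exists>s\<in>{1, -1}. \<forall>\<phi>. antisymmetric \<phi> \<longrightarrow> \<phi> l = s * \<phi> m"
proof (induction l arbitrary: m)
  case Nil
  then show ?case by auto
next
  case (Cons a l)
  have "a \<in> set m" using Cons.prems by (metis list.set_intros(1) set_mset_mset)
  then obtain m1 m2 where m: "m = m1 @ a # m2" by (meson split_list)
  then have "mset l = mset (m1 @ m2)" using Cons.prems by simp
  then obtain s where s: "s \<in> {1, -1}" "\<And>\<phi>. antisymmetric \<phi> \<Longrightarrow> \<phi> l = s * \<phi> (m1 @ m2)"
    using Cons.IH by blast
  have "\<phi> (a # l) = (s * (- 1) ^ length m1) * \<phi> m" if "antisymmetric \<phi>" for \<phi>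
    using s(2)[OF antisymmetric_Cons[OF that, of a]] antisymmetric_move[OF that, of m1 a m2]
    by (simp add: m)
  moreover have "s * (- 1) ^ length m1 \<in> {1, -1}"
    using s(1) by (cases "even (length m1)") auto
  ultimately show ?case by blast
qed

text \<open>Pauli exclusion: with both copies of a repeated entry at the front, exchanging them
  shows that the value is its own negative.\<close>

lemma antisymmetric_not_distinct:
  assumes "antisymmetric \<phi>" "\<not> distinct l"
  shows "\<phi> l = 0"
proof -
  obtain k y k' l' where l: "l = k @ [y] @ k' @ [y] @ l'"
    using not_distinct_decomp[OF assms(2)] by blast
  have "mset l = mset (y # y # k @ k' @ l')" by (simp add: l)
  then obtain s where "\<phi> l = s * \<phi> (y # y # k @ k' @ l')"
    using antisymmetric_perm assms(1) by blast
  moreover have "\<phi> (y # y # k @ k' @ l') = 0"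
    using antisymmetricD[OF assms(1), of "[]" y y "k @ k' @ l'"] by simp
  ultimately show ?thesis by simp
qed

section \<open>Creation operators and the values of \<Phi>\<close>

text \<open>The anticommutation relation evaluated at \<open>l\<close>, with the head
  \<open>a\<close> as the annihilated mode. It gives a recursion along the list that avoids the sum
  over positions in \<open>creat\<close>.\<close>

lemma creat_Cons:
  "complex_of_real (sqrt (real (length l) + 1)) * creat A x \<phi> (a # l) =
     (if a = (x, A) then \<phi> l else 0) - creat A x (annih (snd a) (fst a) \<phi>) l"
  using fun_cong[OF anticommutator[of "snd a" "fst a" A x \<phi>], of l]
  by (simp add: annih_def prod_eq_iff algebra_simps)

lemma creat_uminus: "creat A x (\<lambda>l. - \<phi> l) = (\<lambda>l. - creat A x \<phi> l)"
  by (simp add: creat_def fun_eq_iff minus_divide_left sum_negf[symmetric] if_distrib cong: if_cong)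

lemma antisymmetric_annih:
  assumes "antisymmetric \<phi>"
  shows "antisymmetric (annih A x \<phi>)"
  unfolding antisymmetric_def
proof (intro allI)
  fix k a b l
  show "annih A x \<phi> (k @ a # b # l) = - annih A x \<phi> (k @ b # a # l)"
    using antisymmetricD[OF antisymmetric_Cons[OF assms, of "(x, A)"], of k a b l]
    by (simp only: annih_def length_append length_Cons mult_minus_right)
qed

text \<open>Induction on the prefix before the two exchanged entries. The recursion for
  \<open>creat\<close> strips the first entry and replaces \<phi> by an annihilated \<phi>, so
  \<phi> has to vary in the induction.\<close>

lemma antisymmetric_creat:
  assumes "antisymmetric \<phi>"
  shows "antisymmetric (creat A x \<phi>)"
proof -
  have "creat A x \<phi> (k @ a # b # l) = - creat A x \<phi> (k @ b # a # l)"
    if "antisymmetric \<phi>" for \<phi> k a b l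
    using that
  proof (induction k arbitrary: \<phi>)
    case Nil
    define r where "r k = complex_of_real (sqrt (real k + 1))" for k
    have r0: "r k \<noteq> 0" for k unfolding r_def by (simp del: of_real_sqrt)
    have rC: "r (length l) * creat A x \<psi> (a # l) =
        (if a = (x, A) then \<psi> l else 0) - creat A x (annih (snd a) (fst a) \<psi>) l" for a \<psi> and l :: "('a \<times> 2) list"
      unfolding r_def by (rule creat_Cons)
    \<comment> \<open>Two uses of the recursion. The bracket visibly changes sign when
      \<open>a\<close> and \<open>b\<close> are exchanged; the last term does so because
      annihilators anticommute on antisymmetric functions.\<close>
    have two: "r (length l) * (r (Suc (length l)) * creat A x \<phi> (a # b # l)) =
        r (length l) * ((if a = (x, A) then \<phi> (b # l) else 0) - (if b = (x, A) then \<phi> (a # l) else 0)) +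
        creat A x (annih (snd b) (fst b) (annih (snd a) (fst a) \<phi>)) l" for a b
    proof -
      have an: "annih (snd a) (fst a) \<phi> l = r (length l) * \<phi> (a # l)"
        by (simp add: annih_def r_def)
      have "r (length l) * (r (length (b # l)) * creat A x \<phi> (a # b # l)) =
         r (length l) * (if a = (x, A) then \<phi> (b # l) else 0) -
         r (length l) * creat A x (annih (snd a) (fst a) \<phi>) (b # l)"
        by (subst rC) (simp only: right_diff_distrib)
      also have "\<dots> = r (length l) * (if a = (x, A) then \<phi> (b # l) else 0) -
         ((if b = (x, A) then r (length l) * \<phi> (a # l) else 0) -
         creat A x (annih (snd b) (fst b) (annih (snd a) (fst a) \<phi>)) l)"
        using rC[where l=l and a=b and \<psi>="annih (snd a) (fst a) \<phi>"] an by simp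
      finally show ?thesis by (auto simp: algebra_simps split: if_splits)
    qed
    have "annih (snd b) (fst b) (annih (snd a) (fst a) \<phi>) =
        (\<lambda>l. - annih (snd a) (fst a) (annih (snd b) (fst b) \<phi>) l)"
      by (rule ext) (simp add: annih_def antisymmetricD[OF Nil, of "[]" a b, unfolded append_Nil])
    then have "r (length l) * (r (Suc (length l)) * creat A x \<phi> (a # b # l)) =
        - (r (length l) * (r (Suc (length l)) * creat A x \<phi> (b # a # l)))"
      unfolding two by (simp add: creat_uminus algebra_simps)
    then have "creat A x \<phi> (a # b # l) = - creat A x \<phi> (b # a # l)"
      using r0 by (metis mult_cancel_left mult_minus_right)
    then show ?case by simp
  next
    case (Cons c k)
    define r where "r = complex_of_real (sqrt (real (length (k @ a # b # l)) + 1))"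
    have r0: "r \<noteq> 0" unfolding r_def by (simp del: of_real_sqrt)
    have "r * creat A x \<phi> (c # k @ a # b # l) = - (r * creat A x \<phi> (c # k @ b # a # l))"
      using creat_Cons[of "k @ a # b # l" A x \<phi> c] creat_Cons[of "k @ b # a # l" A x \<phi> c]
      by (simp add: r_def Cons.IH[OF antisymmetric_annih[OF Cons.prems]]
          antisymmetricD[OF Cons.prems, of k a b l])
    then have "creat A x \<phi> (c # k @ a # b # l) = - creat A x \<phi> (c # k @ b # a # l)"
      using r0 by (metis mult_cancel_left mult_minus_right)
    then show ?case by simp
  qed
  then show ?thesis using assms unfolding antisymmetric_def by blast
qed

lemma Phi_Cons: "Phi (x # xs) (A # As) = creat A x (Phi xs As)"
  by (simp add: Phi_def)

lemma Phi_Nil: "Phi [] [] = vac"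
  by (simp add: Phi_def)

lemma antisymmetric_Phi: "length As = length xs \<Longrightarrow> antisymmetric (Phi xs As)"
proof (induction As xs rule: list_induct2)
  case Nil
  then show ?case by (simp add: Phi_Nil antisymmetric_def vac_def)
qed (simp add: Phi_Cons antisymmetric_creat)

lemma creat_nonzero:
  assumes "creat A x \<phi> l \<noteq> 0"
  obtains m where "\<phi> m \<noteq> 0" "mset l = add_mset (x, A) (mset m)"
proof -
  obtain i where i: "i < length l" "l ! i = (x, A)" "\<phi> (take i l @ drop (Suc i) l) \<noteq> 0"
    using assms unfolding creat_def by (auto elim!: sum.not_neutral_contains_not_neutral split: if_splits)
  have "mset l = mset (take i l @ l ! i # drop (Suc i) l)"
    using id_take_nth_drop[OF i(1)] by simp
  then show thesis using that[OF i(3)] i(2) by simp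
qed

lemma Phi_nonzero:
  "length As = length xs \<Longrightarrow> Phi xs As l \<noteq> 0 \<Longrightarrow> mset l = mset (zip xs As)"
proof (induction As xs arbitrary: l rule: list_induct2)
  case Nil
  then show ?case by (simp add: Phi_Nil vac_def split: if_splits)
next
  case (Cons A As x xs)
  then show ?case by (auto simp: Phi_Cons elim!: creat_nonzero)
qed

text \<open>At this list only the first summand of each \<open>creat\<close> survives, since no
  later entry repeats the head. Each creation operator then contributes the inverse square root of
  the current length, whence the factorial.\<close>

lemma Phi_zip:
  "length As = length xs \<Longrightarrow> distinct (zip xs As) \<Longrightarrow>
     (cmod (Phi xs As (zip xs As)))\<^sup>2 = 1 / fact (length xs)"
proof (induction As xs rule: list_induct2)
  case Nil
  then show ?case by (simp add: Phi_Nil vac_def)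
next
  case (Cons A As x xs)
  let ?l = "zip xs As"
  have "(\<Sum>i<length ?l. if ?l ! i = (x, A) then (- 1) ^ Suc i *
      Phi xs As ((x, A) # take i ?l @ drop (Suc i) ?l) else 0) = 0"
    using Cons.prems by (intro sum.neutral) (metis (no_types, lifting) distinct.simps(2) lessThan_iff nth_mem zip_Cons_Cons)
  then have "creat A x (Phi xs As) ((x, A) # ?l) =
      Phi xs As ?l / complex_of_real (sqrt (real (Suc (length ?l))))"
    unfolding creat_def length_Cons sum.lessThan_Suc_shift nth_Cons_Suc take_Suc_Cons drop_Suc_Cons append_Cons
    by (simp del: length_zip nth_zip)
  then show ?case
    using Cons by (simp add: Phi_Cons norm_divide power_divide real_sqrt_pow2 norm_of_real)
qed

text \<open>Reordering \<open>l\<close> changes \<Phi> only by a sign, so the modulus can be read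
  off at \<open>zip xs As\<close>.\<close>

lemma cmod_Phi:
  assumes "length As = length xs" "distinct l"
  shows "(cmod (Phi xs As l))\<^sup>2 = (if mset l = mset (zip xs As) then 1 / fact (length xs) else 0)"
proof (cases "mset l = mset (zip xs As)")
  case True
  then obtain s where "s \<in> {1, -1}" "Phi xs As l = s * Phi xs As (zip xs As)"
    using antisymmetric_perm[OF True] antisymmetric_Phi[OF assms(1)] by blast
  moreover have "distinct (zip xs As)"
    using assms(2) True by (metis distinct_count_atmost_1 set_mset_mset)
  ultimately show ?thesis using Phi_zip[OF assms(1)] True by (auto simp: norm_mult)
qed (use Phi_nonzero[OF assms(1)] in auto)

section \<open>Spin flips and kernels on spin configurations\<close>

definition spin_flip :: "2 \<Rightarrow> 2" where
  "spin_flip A = (if A = 1 then 2 else 1)"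

text \<open>A whole set of points is flipped at once, so that a single flip can connect two spin
  configurations over the same positions. At a point occupied by both spins a flip merely exchanges
  the two entries.\<close>

definition flip_at :: "'p set \<Rightarrow> 'p \<times> 2 \<Rightarrow> 'p \<times> 2" where
  "flip_at X = (\<lambda>(x, A). (x, if x \<in> X then spin_flip A else A))"

lemma spin_flip_eq_iff: "A \<noteq> C \<longleftrightarrow> C = spin_flip A"
  using exhaust_2[of A] exhaust_2[of C] by (auto simp: spin_flip_def)

lemma flip_at_flip_at [simp]: "flip_at X (flip_at X a) = a"
  using exhaust_2[of "snd a"] by (auto simp: flip_at_def spin_flip_def split: prod.splits)

lemma fst_flip_at [simp]: "fst (flip_at X a) = fst a"
  by (simp add: flip_at_def split: prod.splits)

lemma inj_flip_at: "inj_on (flip_at X) S"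
  by (metis flip_at_flip_at inj_onI)

lemma mset_map_flip_at_iff: "mset (map (flip_at X) l) = mset (map (flip_at X) m) \<longleftrightarrow> mset l = mset m"
proof
  assume "mset (map (flip_at X) l) = mset (map (flip_at X) m)"
  then have "image_mset (flip_at X) (mset (map (flip_at X) l)) =
      image_mset (flip_at X) (mset (map (flip_at X) m))" by (rule arg_cong)
  then show "mset l = mset m" unfolding mset_map[symmetric] by (simp add: comp_def del: mset_map)
qed simp

text \<open>Collects the symmetries that determine a kernel up to a factor. Flip invariance is asked
  on the diagonal only, where the phases produced by a rotation cancel.\<close>

definition spin_kernel :: "'p list \<Rightarrow> ('p config \<Rightarrow> 'p config \<Rightarrow> complex) \<Rightarrow> bool" where
  "spin_kernel xs K \<longleftrightarrow>
     (\<forall>m. antisymmetric (\<lambda>l. K l m)) \<and> (\<forall>l. antisymmetric (K l)) \<and>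
     (\<forall>l m. K l m \<noteq> 0 \<longrightarrow> mset (map fst l) = mset xs \<and> mset l = mset m) \<and>
     (\<forall>X l. K (map (flip_at X) l) (map (flip_at X) l) = K l l)"

lemma card_position:
  assumes "distinct l"
  shows "card {a \<in> set l. fst a = x} = count (mset (map fst l)) x"
proof -
  have "count (mset (map fst l)) x = length (filter (\<lambda>a. fst a = x) l)"
    by (induction l) auto
  then show ?thesis using assms by (simp add: distinct_card[symmetric])
qed

text \<open>There are only two spin values and \<open>m\<close> lacks one of them at
  \<open>x\<close>, so \<open>x\<close> is occupied once in \<open>m\<close> and therefore once in
  \<open>l\<close>. Doubly occupied points never distinguish the two configurations.\<close>

lemma same_positions_cases:
  assumes l: "distinct l" and m: "distinct m" and eq: "mset (map fst l) = mset (map fst m)"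
    and a: "(x, A) \<in> set l" "(x, A) \<notin> set m"
  shows "{a \<in> set l. fst a = x} = {(x, A)}" "{a \<in> set m. fst a = x} = {(x, spin_flip A)}"
proof -
  have cards: "card {a \<in> set l. fst a = x} = card {a \<in> set m. fst a = x}"
    by (simp only: card_position l m eq)
  have sub: "{a \<in> set m. fst a = x} \<subseteq> {(x, spin_flip A)}"
    using a(2) spin_flip_eq_iff[of A] by fastforce
  have "{a \<in> set l. fst a = x} \<noteq> {}" using a(1) by auto
  then have "card {a \<in> set l. fst a = x} \<noteq> 0" by (simp add: card_eq_0_iff)
  then have "{a \<in> set m. fst a = x} \<noteq> {}" using cards by (metis card.empty)
  then show m': "{a \<in> set m. fst a = x} = {(x, spin_flip A)}"
    using subset_singletonD[OF sub] by (elim disjE) simp_all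
  then have "card {a \<in> set l. fst a = x} = 1" using cards by simp
  then show "{a \<in> set l. fst a = x} = {(x, A)}"
    using a(1) by (elim card_1_singletonE) force
qed

lemma flip_to:
  assumes l: "distinct l" and m: "distinct m" and eq: "mset (map fst l) = mset (map fst m)"
  shows "\<exists>X. mset (map (flip_at X) l) = mset m"
proof
  \<comment> \<open>The points where the spins differ. By the preceding lemma they are singly
    occupied, with opposite spins in \<open>l\<close> and \<open>m\<close>; everywhere else nothing
    needs to change.\<close>
  let ?X = "fst ` (set l - set m)"
  have d: "distinct (map (flip_at ?X) l)" using l by (simp add: distinct_map inj_flip_at)
  have "flip_at ?X (x, A) \<in> set m" if "(x, A) \<in> set l" for x A
  proof (cases "x \<in> ?X")
    case True
    then obtain C where C: "(x, C) \<in> set l" "(x, C) \<notin> set m" by auto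
    note * = same_positions_cases[OF l m eq C]
    have "(x, A) \<in> {a \<in> set l. fst a = x}" using that by simp
    then have "A = C" unfolding *(1) by simp
    moreover have "(x, spin_flip C) \<in> {a \<in> set m. fst a = x}" unfolding *(2) by simp
    ultimately show ?thesis using True by (simp add: flip_at_def)
  next
    case False
    then show ?thesis using that by (force simp: flip_at_def)
  qed
  then have sub: "set (map (flip_at ?X) l) \<subseteq> set m" by auto
  have "length l = length m" using eq by (metis length_map size_mset)
  then have "card (set (map (flip_at ?X) l)) = card (set m)"
    using d m by (simp only: distinct_card length_map)
  then have "set (map (flip_at ?X) l) = set m"
    using sub by (simp add: card_subset_eq)
  then show "mset (map (flip_at ?X) l) = mset m"
    using d m set_eq_iff_mset_eq_distinct by blast
qed

text \<open>Both arguments are reordered by the same permutation, and its sign enters twice.\<close>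

lemma spin_kernel_diag_cong_mset:
  assumes "spin_kernel xs K" "mset l = mset m"
  shows "K l l = K m m"
proof -
  obtain s where s: "s \<in> {1, -1}" "\<And>\<phi>. antisymmetric \<phi> \<Longrightarrow> \<phi> l = s * \<phi> m"
    using antisymmetric_perm[OF assms(2)] by blast
  have "K l l = s * K m l" "K m l = s * K m m"
    using assms(1) s(2)[of "\<lambda>j. K j l"] s(2)[of "K m"] by (simp_all add: spin_kernel_def)
  then show ?thesis using s(1) by auto
qed

text \<open>The factor \<open>\<kappa>\<close> does not depend on the kernel, so any two kernels are proportional.\<close>
lemma spin_kernel_unique:
  "\<exists>k. \<forall>l m. \<exists>\<kappa>. \<forall>K. spin_kernel xs K \<longrightarrow> K l m = \<kappa> * K k k"
proof -
  \<comment> \<open>The configurations that the Pauli principle allows at the positions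
    \<open>xs\<close>; outside them every kernel vanishes.\<close>
  define adm where "adm l \<longleftrightarrow> distinct l \<and> mset (map fst l) = mset xs" for l :: "'a config"
  have zero: "K l m = 0" if "spin_kernel xs K" "\<not> (adm l \<and> mset l = mset m)" for K l m
    using that antisymmetric_not_distinct[of "\<lambda>l. K l m" l]
    unfolding spin_kernel_def adm_def by blast
  show ?thesis
  proof (cases "\<exists>k. adm k")
    \<comment> \<open>With no allowed configuration, as for three fermions at one point, all kernels
      are zero and any \<open>k\<close> serves.\<close>
    case False
    then show ?thesis using zero by (metis mult_zero_left)
  next
    case True
    then obtain k where k: "adm k" by blast
    have "\<exists>\<kappa>. \<forall>K. spin_kernel xs K \<longrightarrow> K l m = \<kappa> * K k k" for l m
    proof (cases "adm l \<and> mset l = mset m")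
      case False
      then show ?thesis using zero by (metis mult_zero_left)
    next
      case True
      then obtain s where s: "\<And>\<phi>. antisymmetric \<phi> \<Longrightarrow> \<phi> m = s * \<phi> l"
        using antisymmetric_perm[of m l] by metis
      obtain X where X: "mset (map (flip_at X) l) = mset k"
        using flip_to[of l k] True k unfolding adm_def by auto
      \<comment> \<open>Antisymmetry takes \<open>m\<close> to \<open>l\<close>; flip invariance and
        reordering then take the diagonal entry at \<open>l\<close> to the one at \<open>k\<close>.
        Neither \<open>s\<close> nor \<open>X\<close> depends on \<open>K\<close>.\<close>
      have "K l m = s * K k k" if K: "spin_kernel xs K" for K
      proof -
        have "K l m = s * K l l" using K s[of "K l"] by (simp add: spin_kernel_def)
        also have "K l l = K (map (flip_at X) l) (map (flip_at X) l)"
          using K by (simp add: spin_kernel_def)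
        also have "\<dots> = K k k" using spin_kernel_diag_cong_mset[OF K X] .
        finally show ?thesis .
      qed
      then show ?thesis by blast
    qed
    then show ?thesis by blast
  qed
qed

section \<open>The kernel of the sum over \<Phi>\<close>

definition Phi_kernel :: "'p list \<Rightarrow> 'p config \<Rightarrow> 'p config \<Rightarrow> complex" where
  "Phi_kernel xs l m = (\<Sum>As | length As = length xs. Phi xs As l * cnj (Phi xs As m))"

lemma Phi_kernel_diag:
  "Phi_kernel xs l l = of_real (\<Sum>As | length As = length xs. (cmod (Phi xs As l))\<^sup>2)"
  by (simp add: Phi_kernel_def complex_norm_square del: of_real_power)

lemma mset_map_fst_zip:
  assumes "length As = length xs" "mset l = mset (zip xs As)"
  shows "mset (map fst l) = mset xs"
  using assms by (metis map_fst_zip mset_map)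

lemma spin_kernel_Phi_kernel: "spin_kernel xs (Phi_kernel xs)"
  unfolding spin_kernel_def
proof (intro conjI allI impI)
  fix m show "antisymmetric (\<lambda>l. Phi_kernel xs l m)"
    unfolding Phi_kernel_def mult.commute[of "Phi _ _ _"]
    by (intro antisymmetric_sum antisymmetric_cmult antisymmetric_Phi) simp
next
  fix l
  have "antisymmetric (\<lambda>m. cnj (Phi xs As m))" if "length As = length xs" for As
    using antisymmetric_Phi[OF that] unfolding antisymmetric_def by (metis complex_cnj_minus)
  then show "antisymmetric (Phi_kernel xs l)"
    unfolding Phi_kernel_def by (intro antisymmetric_sum antisymmetric_cmult) simp
next
  fix l m assume "Phi_kernel xs l m \<noteq> 0"
  then obtain As where As: "length As = length xs" "Phi xs As l \<noteq> 0" "Phi xs As m \<noteq> 0"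
    unfolding Phi_kernel_def by (auto elim!: sum.not_neutral_contains_not_neutral)
  then show "mset (map fst l) = mset xs" "mset l = mset m"
    using Phi_nonzero mset_map_fst_zip by metis+
next
  fix X and l :: "'a config"
  \<comment> \<open>The spin assignment with the fermions at points of \<open>X\<close> flipped. It
    is an involution on the assignments, and reindexing by it absorbs the flip of \<open>l\<close>,
    because on the diagonal only moduli enter.\<close>
  let ?f = "\<lambda>As. map snd (map (flip_at X) (zip xs As))"
  have zip_f: "zip xs (?f As) = map (flip_at X) (zip xs As)" if "length As = length xs" for As
    using that by (intro nth_equalityI) (auto simp: prod_eq_iff)
  show "Phi_kernel xs (map (flip_at X) l) (map (flip_at X) l) = Phi_kernel xs l l"
  proof (cases "distinct l")
    case True
    then have d: "distinct (map (flip_at X) l)" by (simp add: distinct_map inj_flip_at)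
    have inv: "?f (?f As) = As" if "length As = length xs" for As
      unfolding zip_f[OF that] using that by (simp add: comp_def)
    have "mset (map (flip_at X) l) = mset (zip xs (?f As)) \<longleftrightarrow> mset l = mset (zip xs As)"
      if "length As = length xs" for As
      unfolding zip_f[OF that] by (rule mset_map_flip_at_iff)
    then have "(\<Sum>As | length As = length xs. (cmod (Phi xs As l))\<^sup>2) =
        (\<Sum>As | length As = length xs. (cmod (Phi xs As (map (flip_at X) l)))\<^sup>2)"
      by (intro sum.reindex_bij_witness[where i="?f" and j="?f"])
        (auto simp: inv cmod_Phi True d simp del: map_map)
    then show ?thesis by (simp add: Phi_kernel_diag)
  next
    case False
    then have "\<not> distinct (map (flip_at X) l)" by (simp add: distinct_map inj_flip_at)
    then have "Phi xs As l = 0" "Phi xs As (map (flip_at X) l) = 0" if "length As = length xs" for As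
      using antisymmetric_not_distinct[OF antisymmetric_Phi[OF that]] False by blast+
    then show ?thesis by (simp add: Phi_kernel_def)
  qed
qed

section \<open>Gauge transformations by monomial matrices\<close>

lemma prod_list_nth: "(\<Prod>i<length l. f (l ! i)) = prod_list (map f l)" for f :: "'b \<Rightarrow> complex"
  by (simp add: prod.list_conv_set_nth atLeast0LessThan)

text \<open>\<open>p x A\<close> is the row of the only possibly nonzero entry in column
  \<open>A\<close> of \<open>g x\<close>, so a single list of spins survives in the sum. The
  diagonal phase and the spin exchange used below are both of this kind.\<close>

lemma gauge_Fock_monomial:
  assumes "\<And>x A C. C \<noteq> p x A \<Longrightarrow> g x $ C $ A = 0"
  shows "gauge_Fock g \<phi> l = prod_list (map (\<lambda>(x, A). cnj (g x $ p x A $ A)) l) *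
      \<phi> (map (\<lambda>(x, A). (x, p x A)) l)"
proof -
  let ?t = "\<lambda>Bs. (\<Prod>i<length l. cnj (g (fst (l ! i)) $ (Bs ! i) $ snd (l ! i))) * \<phi> (zip (map fst l) Bs)"
  let ?B = "map (\<lambda>(x, A). p x A) l"
  have "?t Bs = 0" if "length Bs = length l" "Bs \<noteq> ?B" for Bs
  proof -
    obtain i where i: "i < length l" "Bs ! i \<noteq> p (fst (l ! i)) (snd (l ! i))"
      using \<open>Bs \<noteq> ?B\<close> \<open>length Bs = length l\<close> by (auto simp: list_eq_iff_nth_eq split_def)
    then have "\<exists>i\<in>{..<length l}. cnj (g (fst (l ! i)) $ (Bs ! i) $ snd (l ! i)) = 0"
      using assms by (intro bexI[of _ i]) auto
    then show ?thesis by simp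
  qed
  then have "gauge_Fock g \<phi> l = sum ?t {?B}"
    unfolding gauge_Fock_def by (intro sum.mono_neutral_right finite_lists_length) auto
  also have "\<dots> = (\<Prod>i<length l. (\<lambda>(x, A). cnj (g x $ p x A $ A)) (l ! i)) * \<phi> (zip (map fst l) ?B)"
    by (simp add: split_def)
  also have "zip (map fst l) ?B = map (\<lambda>(x, A). (x, p x A)) l"
    by (simp add: zip_map_map zip_same_conv_map split_def)
  finally show ?thesis unfolding prod_list_nth .
qed

section \<open>Gauge invariance of the Ashtekar--Lewandowski measure\<close>

lemma adj_adj [simp]: "adj (adj U) = U"
  by (simp add: adj_def vec_eq_iff)

lemma adj_mult: "adj (U ** V) = adj V ** adj U"
  by (simp add: adj_def vec_eq_iff matrix_matrix_mult_def mult.commute)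

lemma SU2_adj_left: "U \<in> SU2 \<Longrightarrow> adj U ** U = mat 1"
  by (simp add: SU2_def matrix_left_right_inverse)

lemma SU2_adj_right: "U \<in> SU2 \<Longrightarrow> U ** adj U = mat 1"
  by (simp add: SU2_def)

lemma SU2_adj: "U \<in> SU2 \<Longrightarrow> adj U \<in> SU2"
  using SU2_adj_left[of U]
  by (auto simp: SU2_def det_2 adj_def mult.commute simp flip: complex_cnj_mult complex_cnj_diff)

lemma mat_1_SU2: "(mat 1 :: complex^2^2) \<in> SU2"
  by (simp add: SU2_def) (simp add: adj_def mat_def vec_eq_iff)

lemma SU2_mult: "U \<in> SU2 \<Longrightarrow> V \<in> SU2 \<Longrightarrow> U ** V \<in> SU2"
  using SU2_adj_right[of V]
  by (simp add: SU2_def det_mul adj_mult matrix_mul_assoc)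
     (simp add: matrix_mul_assoc[symmetric])

lemma matrix_inv_SU2:
  assumes "U \<in> SU2"
  shows "matrix_inv U = adj U"
proof -
  have "U ** matrix_inv U = mat 1"
    unfolding matrix_inv_def
    using someI[of "\<lambda>V. U ** V = mat 1 \<and> V ** U = mat 1" "adj U"]
      SU2_adj_left[OF assms] SU2_adj_right[OF assms] by blast
  then have "adj U ** U ** matrix_inv U = adj U"
    by (simp add: matrix_mul_assoc[symmetric])
  then show ?thesis by (simp add: SU2_adj_left[OF assms])
qed

section \<open>Gauge action on generalized connections\<close>

text \<open>The substitution multiplies the k-th Taylor coefficient by \<open>q ^ k\<close> and
  divides the radius by \<bar>q\<bar>; the velocity stays nonzero. Reversed edges and both pieces of
  a subdivided edge are instances.\<close>

lemma edges_affine: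
  assumes e: "e \<in> edges \<A>" and q: "q \<noteq> 0"
    and \<sigma>: "\<And>s. s \<in> {0..1} \<Longrightarrow> p + q * s \<in> {0..1}"
  shows "(\<lambda>s. e (p + q * s)) \<in> edges \<A>"
proof -
  let ?\<sigma> = "\<lambda>s. p + q * s"
  have "arc (\<lambda>s. e (?\<sigma> s))"
    unfolding arc_def
  proof
    show "path (\<lambda>s. e (?\<sigma> s))"
      unfolding path_def
      by (rule continuous_on_compose2[of "{0..1}" e])
        (use e \<sigma> in \<open>auto simp: edges_def arc_def path_def intro!: continuous_intros\<close>)
    have "inj_on e {0..1}" using e by (simp add: edges_def arc_def)
    then show "inj_on (\<lambda>s. e (?\<sigma> s)) {0..1}"
      using \<sigma> q unfolding inj_on_def by (metis add_left_cancel mult_cancel_left)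
  qed
  moreover have "\<exists>r>0. \<exists>a :: nat \<Rightarrow> real^3. a 1 \<noteq> 0 \<and>
      (\<forall>s\<in>{0..1}. \<bar>s - t\<bar> < r \<longrightarrow> e (?\<sigma> s) \<in> U \<and> (\<lambda>k. (s - t) ^ k *\<^sub>R a k) sums c (e (?\<sigma> s)))"
    if Uc: "(U, c) \<in> \<A>" and t: "t \<in> {0..1}" "e (?\<sigma> t) \<in> U" for U c t
  proof -
    obtain r a where r: "r > 0" and a: "a 1 \<noteq> (0 :: real^3)"
      and *: "\<And>s. s \<in> {0..1} \<Longrightarrow> \<bar>s - ?\<sigma> t\<bar> < r \<Longrightarrow>
        e s \<in> U \<and> (\<lambda>k. (s - ?\<sigma> t) ^ k *\<^sub>R a k) sums c (e s)"
      using bspec[OF conjunct2[OF e[unfolded edges_def mem_Collect_eq]] Uc, unfolded prod.case,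
          rule_format, OF \<sigma>[OF t(1)] t(2)] by (elim exE conjE) simp
    have "e (?\<sigma> s) \<in> U \<and> (\<lambda>k. (s - t) ^ k *\<^sub>R (q ^ k *\<^sub>R a k)) sums c (e (?\<sigma> s))"
      if s: "s \<in> {0..1}" "\<bar>s - t\<bar> < r / \<bar>q\<bar>" for s
    proof -
      have diff: "?\<sigma> s - ?\<sigma> t = q * (s - t)" by (simp add: algebra_simps)
      have "\<bar>?\<sigma> s - ?\<sigma> t\<bar> < r"
        using s(2) q unfolding diff by (simp only: abs_mult) (simp add: pos_less_divide_eq mult.commute)
      from *[OF \<sigma>[OF s(1)] this] show ?thesis
        unfolding diff by (simp add: power_mult_distrib mult.commute)
    qed
    then show ?thesis
      using r a q by (intro exI[of _ "r / \<bar>q\<bar>"] conjI exI[of _ "\<lambda>k. q ^ k *\<^sub>R a k"]) auto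
  qed
  ultimately show ?thesis unfolding edges_def by blast
qed

text \<open>The gauge factors sit at the end points of an edge: reparametrization fixes these,
  reversal exchanges them, and under subdivision the two factors at the intermediate point
  cancel.\<close>

lemma gauge_conn_gen_conns:
  assumes g: "gauge_transf g" and A: "A \<in> gen_conns \<A>"
  shows "gauge_conn \<A> g A \<in> gen_conns \<A>"
proof -
  have gS: "g x \<in> SU2" for x using g by (auto simp: gauge_transf_def)
  have AS: "A e \<in> SU2" if "e \<in> edges \<A>" for e using A that by (auto simp: gen_conns_def)
  have G: "gauge_conn \<A> g A e = g (e 1) ** A e ** adj (g (e 0))" if "e \<in> edges \<A>" for e
    using that by (simp add: gauge_conn_def matrix_inv_SU2 gS pathfinish_def pathstart_def)
  have GS: "gauge_conn \<A> g A e \<in> SU2" if "e \<in> edges \<A>" for e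
    by (simp add: G that SU2_mult SU2_adj gS AS)
  have "gauge_conn \<A> g A \<in> edges \<A> \<rightarrow>\<^sub>E SU2"
    using GS by (auto simp: gauge_conn_def)
  moreover have "gauge_conn \<A> g A e' = gauge_conn \<A> g A e"
    if e: "e \<in> edges \<A>" "e' \<in> edges \<A>" and \<phi>: "continuous_on {0..1} \<phi>" "strict_mono_on {0..1} \<phi>"
      "\<phi> 0 = 0" "\<phi> 1 = 1" "\<forall>s\<in>{0..1}. e' s = e (\<phi> s)" for e e' and \<phi> :: "real \<Rightarrow> real"
  proof -
    have "A e' = A e" using A e \<phi> unfolding gen_conns_def by blast
    moreover have "e' 0 = e 0" "e' 1 = e 1" using \<phi> by simp_all
    ultimately show ?thesis by (simp add: G e)
  qed
  moreover have "gauge_conn \<A> g A (reversepath e) = matrix_inv (gauge_conn \<A> g A e)"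
    if e: "e \<in> edges \<A>" for e
  proof -
    have "reversepath e = (\<lambda>s. e (1 + - 1 * s))" by (simp add: reversepath_def)
    then have r: "reversepath e \<in> edges \<A>" using edges_affine[OF e, of "-1" 1] by simp
    have "A (reversepath e) = adj (A e)"
      using A e AS unfolding gen_conns_def by (auto simp: matrix_inv_SU2)
    then show ?thesis
      by (simp add: matrix_inv_SU2 GS e)
        (simp add: G[OF e] G[OF r] adj_mult matrix_mul_assoc, simp add: reversepath_def)
  qed
  moreover have "gauge_conn \<A> g A e =
      gauge_conn \<A> g A (\<lambda>s. e (\<tau> + (1 - \<tau>) * s)) ** gauge_conn \<A> g A (\<lambda>s. e (\<tau> * s))"
    if e: "e \<in> edges \<A>" and \<tau>: "\<tau> \<in> {0<..<1}" for e \<tau>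
  proof -
    have "\<tau> + (1 - \<tau>) * s \<le> 1" if "s \<in> {0..1}" for s
    proof -
      have "(1 - \<tau>) * s \<le> (1 - \<tau>) * 1" using that \<tau> by (intro mult_left_mono) auto
      then show ?thesis by simp
    qed
    then have e1: "(\<lambda>s. e (\<tau> + (1 - \<tau>) * s)) \<in> edges \<A>"
      using \<tau> by (intro edges_affine[OF e]) auto
    have e2: "(\<lambda>s. e (\<tau> * s)) \<in> edges \<A>"
      using \<tau> edges_affine[OF e, of \<tau> 0] by (simp add: mult_le_one)
    have "A e = A (\<lambda>s. e (\<tau> + (1 - \<tau>) * s)) ** A (\<lambda>s. e (\<tau> * s))"
      using A e \<tau> unfolding gen_conns_def by blast
    moreover have "adj (g (e \<tau>)) ** (g (e \<tau>) ** Y) = Y" for Y :: "complex^2^2"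
      by (simp add: matrix_mul_assoc SU2_adj_left gS)
    ultimately show ?thesis
      by (simp add: G e e1 e2 matrix_mul_assoc[symmetric])
  qed
  ultimately show ?thesis unfolding gen_conns_def by blast
qed

section \<open>Translations and products of Haar measure\<close>

lemma continuous_on_matrix_mult [continuous_intros]:
  fixes f :: "'a::topological_space \<Rightarrow> complex^'n^'m" and g :: "'a \<Rightarrow> complex^'k^'n"
  shows "continuous_on S f \<Longrightarrow> continuous_on S g \<Longrightarrow> continuous_on S (\<lambda>x. f x ** g x)"
  unfolding matrix_matrix_mult_def by (intro continuous_intros)

lemma measurable_translate:
  assumes \<eta>: "is_haar_SU2 \<eta>" and ab: "a \<in> SU2" "b \<in> SU2"
  shows "(\<lambda>h. a ** h ** b) \<in> measurable \<eta> \<eta>"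
proof -
  have "(\<lambda>h. a ** h ** b) \<in> borel_measurable borel"
    by (intro borel_measurable_continuous_onI continuous_intros)
  then have "(\<lambda>h. a ** h ** b) \<in> measurable (restrict_space borel SU2) (restrict_space borel SU2)"
    by (rule measurable_restrict_space3) (use ab in \<open>auto intro!: SU2_mult\<close>)
  moreover have "sets \<eta> = sets (restrict_space borel SU2)" using \<eta> by (simp add: is_haar_SU2_def)
  ultimately show ?thesis using measurable_cong_sets by blast
qed

lemma distr_translate:
  assumes \<eta>: "is_haar_SU2 \<eta>" and ab: "a \<in> SU2" "b \<in> SU2"
  shows "distr \<eta> \<eta> (\<lambda>h. a ** h ** b) = \<eta>"
proof -
  have "distr \<eta> \<eta> (\<lambda>h. a ** h ** b) = distr (distr \<eta> \<eta> (\<lambda>h. a ** h)) \<eta> (\<lambda>h. h ** b)"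
    using measurable_translate[OF \<eta> ab(1) mat_1_SU2] measurable_translate[OF \<eta> mat_1_SU2 ab(2)]
    by (simp add: distr_distr comp_def)
  then show ?thesis using \<eta> ab by (simp add: is_haar_SU2_def)
qed

text \<open>The preimage of a box under a componentwise map is again a box, and on finite products
  boxes determine the measure.\<close>

lemma distr_PiM_componentwise:
  assumes fin: "finite I" and M: "\<And>i. i \<in> I \<Longrightarrow> prob_space (M i)"
    and t: "\<And>i. i \<in> I \<Longrightarrow> t i \<in> measurable (M i) (M i)" "\<And>i. i \<in> I \<Longrightarrow> distr (M i) (M i) (t i) = M i"
  shows "distr (PiM I M) (PiM I M) (\<lambda>h. \<lambda>i\<in>I. t i (h i)) = PiM I M"
proof -
  \<comment> \<open>Extended by a point mass outside \<open>I\<close>, because the product locale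
    asks for a sigma-finite measure at every index.\<close>
  define N where "N i = (if i \<in> I then M i else return (count_space UNIV) undefined)" for i
  have N: "prob_space (N i)" for i using M by (auto simp: N_def prob_space_return)
  then interpret product_sigma_finite N
    by (simp add: product_sigma_finite_def prob_space_imp_sigma_finite)
  have eq: "PiM I M = PiM I N" by (intro PiM_cong) (simp_all add: N_def)
  have tN: "t i \<in> measurable (N i) (N i)" "distr (N i) (N i) (t i) = N i" if "i \<in> I" for i
    using t that by (simp_all add: N_def)
  have T: "(\<lambda>h. \<lambda>i\<in>I. t i (h i)) \<in> measurable (PiM I N) (PiM I N)"
    by (rule measurable_restrict)
      (rule measurable_compose[OF measurable_component_singleton[where M=N]], assumption, rule tN(1))
  show ?thesis unfolding eq
  proof (rule PiM_eqI[OF fin])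
    fix A assume A: "\<And>i. i \<in> I \<Longrightarrow> A i \<in> sets (N i)"
    have pre: "t i -` A i \<inter> space (N i) \<in> sets (N i)" if "i \<in> I" for i
      using measurable_sets[OF tN(1)[OF that] A[OF that]] .
    have "(\<lambda>h. \<lambda>i\<in>I. t i (h i)) -` Pi\<^sub>E I A \<inter> space (PiM I N) =
        Pi\<^sub>E I (\<lambda>i. t i -` A i \<inter> space (N i))"
      by (auto simp: space_PiM PiE_iff)
    then have "emeasure (distr (PiM I N) (PiM I N) (\<lambda>h. \<lambda>i\<in>I. t i (h i))) (Pi\<^sub>E I A) =
        emeasure (PiM I N) (Pi\<^sub>E I (\<lambda>i. t i -` A i \<inter> space (N i)))"
      using A fin by (subst emeasure_distr[OF T]) (auto intro!: sets_PiM_I_finite)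
    also have "\<dots> = (\<Prod>i\<in>I. emeasure (N i) (t i -` A i \<inter> space (N i)))"
      using pre fin by (intro emeasure_PiM) auto
    also have "\<dots> = (\<Prod>i\<in>I. emeasure (distr (N i) (N i) (t i)) (A i))"
      using A tN(1) by (intro prod.cong refl) (simp add: emeasure_distr)
    also have "\<dots> = (\<Prod>i\<in>I. emeasure (N i) (A i))"
      by (intro prod.cong refl) (simp add: tN(2))
    finally show "emeasure (distr (PiM I N) (PiM I N) (\<lambda>h. \<lambda>i\<in>I. t i (h i))) (Pi\<^sub>E I A) =
        (\<Prod>i\<in>I. emeasure (N i) (A i))" .
  qed simp
qed

section \<open>Invariance of the marginals\<close>

context
  fixes \<A> :: "'p::topological_space atlas" and \<eta> \<mu> and g :: "'p \<Rightarrow> complex^2^2"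
  assumes \<eta>: "is_haar_SU2 \<eta>" and \<mu>: "haar_marginals \<A> \<eta> \<mu>" and g: "gauge_transf g"
begin

lemma measurable_holonomy:
  assumes "e \<in> edges \<A>"
  shows "(\<lambda>A. A e) \<in> borel_measurable \<mu>" "(\<lambda>A. A e) \<in> measurable \<mu> \<eta>"
proof -
  have s: "sets \<mu> = sets (restrict_space (PiM (edges \<A>) (\<lambda>_. borel)) (gen_conns \<A>))"
    using \<mu> by (simp add: haar_marginals_def)
  show b: "(\<lambda>A. A e) \<in> borel_measurable \<mu>"
    unfolding measurable_cong_sets[OF s refl]
    by (intro measurable_restrict_space1 measurable_component_singleton assms)
  have "(\<lambda>A. A e) \<in> measurable \<mu> (restrict_space borel SU2)"
    by (intro measurable_restrict_space2 b)
      (use \<mu> assms in \<open>auto simp: haar_marginals_def gen_conns_def\<close>)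
  moreover have "sets \<eta> = sets (restrict_space borel SU2)" using \<eta> by (simp add: is_haar_SU2_def)
  ultimately show "(\<lambda>A. A e) \<in> measurable \<mu> \<eta>" using measurable_cong_sets by blast
qed

lemma measurable_gauge_conn: "gauge_conn \<A> g \<in> measurable \<mu> \<mu>"
proof -
  have s: "sets \<mu> = sets (restrict_space (PiM (edges \<A>) (\<lambda>_. borel)) (gen_conns \<A>))"
    and sp: "space \<mu> = gen_conns \<A>"
    using \<mu> by (simp_all add: haar_marginals_def)
  have "(\<lambda>A. g (pathfinish e) ** A e ** matrix_inv (g (pathstart e))) \<in> borel_measurable \<mu>"
    if "e \<in> edges \<A>" for e
    by (rule measurable_compose[OF measurable_holonomy(1)[OF that]])
      (intro borel_measurable_continuous_onI continuous_intros)
  then have "gauge_conn \<A> g \<in> measurable \<mu> (PiM (edges \<A>) (\<lambda>_. borel))"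
    unfolding gauge_conn_def by (intro measurable_restrict)
  then show ?thesis
    unfolding measurable_cong_sets[OF refl s]
    by (intro measurable_restrict_space2) (auto simp: sp gauge_conn_gen_conns g)
qed

text \<open>For fixed \<open>g\<close> the transformation acts on a graph edge by edge, by a left
  and a right translation. Hence it commutes with restriction to the graph and preserves product
  Haar measure, even when edges share vertices.\<close>

lemma haar_marginals_distr_gauge_conn:
  "haar_marginals \<A> \<eta> (distr \<mu> \<mu> (gauge_conn \<A> g))"
  unfolding haar_marginals_def
proof (intro conjI allI impI)
  interpret prob_space \<mu> using \<mu> by (simp add: haar_marginals_def)
  show "prob_space (distr \<mu> \<mu> (gauge_conn \<A> g))"
    by (rule prob_space_distr[OF measurable_gauge_conn])
  show "space (distr \<mu> \<mu> (gauge_conn \<A> g)) = gen_conns \<A>"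
    "sets (distr \<mu> \<mu> (gauge_conn \<A> g)) =
       sets (restrict_space (PiM (edges \<A>) (\<lambda>_. borel)) (gen_conns \<A>))"
    using \<mu> by (simp_all add: haar_marginals_def)
next
  fix \<gamma> assume \<gamma>: "is_graph \<A> \<gamma>"
  let ?P = "PiM \<gamma> (\<lambda>_. \<eta>)"
  let ?t = "\<lambda>e h. g (pathfinish e) ** h ** adj (g (pathstart e))"
  let ?T = "\<lambda>h. \<lambda>e\<in>\<gamma>. ?t e (h e)"
  have gS: "g x \<in> SU2" for x using g by (auto simp: gauge_transf_def)
  have sub: "\<gamma> \<subseteq> edges \<A>" and fin: "finite \<gamma>" using \<gamma> by (simp_all add: is_graph_def)
  have R: "(\<lambda>A. restrict A \<gamma>) \<in> measurable \<mu> ?P"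
    using sub by (intro measurable_restrict measurable_holonomy(2)) auto
  have t: "?t e \<in> measurable \<eta> \<eta>" "distr \<eta> \<eta> (?t e) = \<eta>" for e
    by (simp_all add: measurable_translate distr_translate \<eta> gS SU2_adj)
  have T: "?T \<in> measurable ?P ?P"
    by (rule measurable_restrict)
      (rule measurable_compose[OF measurable_component_singleton[where M="\<lambda>_. \<eta>"]], assumption, rule t(1))
  have "distr (distr \<mu> \<mu> (gauge_conn \<A> g)) ?P (\<lambda>A. restrict A \<gamma>) =
      distr \<mu> ?P ((\<lambda>A. restrict A \<gamma>) \<circ> gauge_conn \<A> g)"
    by (rule distr_distr[OF R measurable_gauge_conn])
  also have "(\<lambda>A. restrict A \<gamma>) \<circ> gauge_conn \<A> g = ?T \<circ> (\<lambda>A. restrict A \<gamma>)"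
    using sub by (auto simp: fun_eq_iff gauge_conn_def matrix_inv_SU2 gS)
  also have "distr \<mu> ?P (?T \<circ> (\<lambda>A. restrict A \<gamma>)) = distr (distr \<mu> ?P (\<lambda>A. restrict A \<gamma>)) ?P ?T"
    by (rule distr_distr[OF T R, symmetric])
  also have "distr \<mu> ?P (\<lambda>A. restrict A \<gamma>) = ?P" using \<mu> \<gamma> by (simp add: haar_marginals_def)
  also have "distr ?P ?P ?T = ?P"
    by (rule distr_PiM_componentwise[OF fin _ t]) (use \<eta> in \<open>simp add: is_haar_SU2_def\<close>)
  finally show "distr (distr \<mu> \<mu> (gauge_conn \<A> g)) ?P (\<lambda>A. restrict A \<gamma>) = ?P" .
qed

end

text \<open>The transformed measure has the same Haar marginals, so the uniqueness clause of
  \<open>is_AL_measure\<close> identifies it with \<mu>.\<close>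

lemma distr_gauge_conn:
  "is_haar_SU2 \<eta> \<Longrightarrow> is_AL_measure \<A> \<eta> \<mu> \<Longrightarrow> gauge_transf g \<Longrightarrow> distr \<mu> \<mu> (gauge_conn \<A> g) = \<mu>"
  using haar_marginals_distr_gauge_conn unfolding is_AL_measure_def by blast

section \<open>Parseval's identity\<close>

lemma borel_measurable_cnj:
  "f \<in> borel_measurable M \<Longrightarrow> (\<lambda>x. cnj (f x)) \<in> borel_measurable M"
  by (rule measurable_compose[OF _ borel_measurable_continuous_onI[OF continuous_on_cnj[OF continuous_on_id]]])

lemma L2_mult_integrable:
  assumes "f \<in> L2 \<mu>" "h \<in> L2 \<mu>"
  shows "integrable \<mu> (\<lambda>A. cnj (f A) * h A)"
proof (rule Bochner_Integration.integrable_bound)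
  show "integrable \<mu> (\<lambda>A. (cmod (f A))\<^sup>2 + (cmod (h A))\<^sup>2)"
    using assms by (simp add: L2_def)
  show "(\<lambda>A. cnj (f A) * h A) \<in> borel_measurable \<mu>"
    using assms by (auto simp: L2_def intro!: borel_measurable_times borel_measurable_cnj)
  have "cmod (f A) * cmod (h A) \<le> (cmod (f A))\<^sup>2 + (cmod (h A))\<^sup>2" for A
    using sum_squares_bound[of "cmod (f A)" "cmod (h A)"]
      mult_nonneg_nonneg[OF norm_ge_zero norm_ge_zero, of "f A" "h A"] by linarith
  then show "AE A in \<mu>. cmod (cnj (f A) * h A) \<le> norm ((cmod (f A))\<^sup>2 + (cmod (h A))\<^sup>2)"
    by (simp add: norm_mult)
qed

lemma L2_cmult: "f \<in> L2 \<mu> \<Longrightarrow> (\<lambda>A. c * f A) \<in> L2 \<mu>"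
  by (auto simp: L2_def norm_mult power_mult_distrib)

lemma L2_add:
  assumes "f \<in> L2 \<mu>" "h \<in> L2 \<mu>"
  shows "(\<lambda>A. f A + h A) \<in> L2 \<mu>"
  unfolding L2_def
proof (intro CollectI conjI)
  show m: "(\<lambda>A. f A + h A) \<in> borel_measurable \<mu>" using assms by (auto simp: L2_def)
  have "integrable \<mu> (\<lambda>A. 2 * (cmod (f A))\<^sup>2 + 2 * (cmod (h A))\<^sup>2)"
    using assms by (simp add: L2_def)
  then show "integrable \<mu> (\<lambda>A. (cmod (f A + h A))\<^sup>2)"
  proof (rule Bochner_Integration.integrable_bound)
    show "(\<lambda>A. (cmod (f A + h A))\<^sup>2) \<in> borel_measurable \<mu>" using m by measurable
    have "(cmod (f A + h A))\<^sup>2 \<le> 2 * (cmod (f A))\<^sup>2 + 2 * (cmod (h A))\<^sup>2" for A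
    proof -
      have "(cmod (f A + h A))\<^sup>2 \<le> (cmod (f A) + cmod (h A))\<^sup>2"
        by (intro power_mono norm_triangle_ineq) simp
      then show ?thesis using sum_squares_bound[of "cmod (f A)" "cmod (h A)"]
        by (simp add: power2_sum)
    qed
    then show "AE A in \<mu>. norm ((cmod (f A + h A))\<^sup>2) \<le> norm (2 * (cmod (f A))\<^sup>2 + 2 * (cmod (h A))\<^sup>2)"
      by simp
  qed
qed

lemma L2_zero: "(\<lambda>A. 0) \<in> L2 \<mu>"
  by (simp add: L2_def)

lemma L2_sum: "(\<And>i. i \<in> I \<Longrightarrow> f i \<in> L2 \<mu>) \<Longrightarrow> (\<lambda>A. \<Sum>i\<in>I. f i A) \<in> L2 \<mu>"
  by (induction I rule: infinite_finite_induct) (simp_all add: L2_zero L2_add)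

lemma L2_diff:
  assumes "f \<in> L2 \<mu>" "h \<in> L2 \<mu>"
  shows "(\<lambda>A. f A - h A) \<in> L2 \<mu>"
  using L2_add[OF assms(1) L2_cmult[OF assms(2), of "-1"]] by simp

lemma L2_inner_add_right:
  "f \<in> L2 \<mu> \<Longrightarrow> h \<in> L2 \<mu> \<Longrightarrow> k \<in> L2 \<mu> \<Longrightarrow>
     L2_inner \<mu> f (\<lambda>A. h A + k A) = L2_inner \<mu> f h + L2_inner \<mu> f k"
  unfolding L2_inner_def distrib_left by (intro Bochner_Integration.integral_add L2_mult_integrable)

lemma L2_inner_cmult_right: "L2_inner \<mu> f (\<lambda>A. c * h A) = c * L2_inner \<mu> f h"
  unfolding L2_inner_def by (simp add: mult.left_commute)

lemma cnj_L2_inner: "cnj (L2_inner \<mu> f h) = L2_inner \<mu> h f"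
  unfolding L2_inner_def by (simp add: mult.commute flip: Bochner_Integration.integral_cnj)

lemma L2_inner_self: "L2_inner \<mu> f f = complex_of_real (\<integral>A. (cmod (f A))\<^sup>2 \<partial>\<mu>)"
  unfolding L2_inner_def
  by (subst integral_complex_of_real[symmetric]) (simp only: complex_norm_square mult.commute)

lemma L2_inner_diff_right:
  assumes "f \<in> L2 \<mu>" "h \<in> L2 \<mu>" "k \<in> L2 \<mu>"
  shows "L2_inner \<mu> f (\<lambda>A. h A - k A) = L2_inner \<mu> f h - L2_inner \<mu> f k"
  using L2_inner_add_right[OF assms(1,2) L2_cmult[OF assms(3), of "-1"]]
    L2_inner_cmult_right[of \<mu> f "-1" k] by simp

lemma L2_inner_sum_right:
  "f \<in> L2 \<mu> \<Longrightarrow> (\<And>i. i \<in> I \<Longrightarrow> h i \<in> L2 \<mu>) \<Longrightarrow>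
     L2_inner \<mu> f (\<lambda>A. \<Sum>i\<in>I. h i A) = (\<Sum>i\<in>I. L2_inner \<mu> f (h i))"
  unfolding L2_inner_def sum_distrib_left
  by (intro Bochner_Integration.integral_sum L2_mult_integrable)

lemma L2_inner_cong_AE:
  assumes "f \<in> borel_measurable \<mu>" "f' \<in> borel_measurable \<mu>" "h \<in> borel_measurable \<mu>" "h' \<in> borel_measurable \<mu>"
    "AE A in \<mu>. f A = f' A" "AE A in \<mu>. h A = h' A"
  shows "L2_inner \<mu> f h = L2_inner \<mu> f' h'"
  unfolding L2_inner_def
proof (rule integral_cong_AE)
  show "(\<lambda>A. cnj (f A) * h A) \<in> borel_measurable \<mu>" "(\<lambda>A. cnj (f' A) * h' A) \<in> borel_measurable \<mu>"
    using assms by (auto intro!: borel_measurable_times borel_measurable_cnj)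
  show "AE A in \<mu>. cnj (f A) * h A = cnj (f' A) * h' A"
    using assms(5,6) by eventually_elim simp
qed

section \<open>Expansion in an orthonormal basis\<close>

context
  fixes \<mu> :: "'a measure" and B :: "('a \<Rightarrow> complex) set"
  assumes B: "L2_onb \<mu> B"
begin

lemma onb_L2: "S \<in> B \<Longrightarrow> S \<in> L2 \<mu>"
  using B by (auto simp: L2_onb_def)

text \<open>Completing the square in the coefficients. The last sum vanishes exactly for the Fourier
  coefficients, which therefore give the best approximation.\<close>

lemma L2_dist_onb:
  assumes f: "f \<in> L2 \<mu>" and F: "finite F" "F \<subseteq> B"
  shows "(\<integral>A. (cmod (f A - (\<Sum>S\<in>F. c S * S A)))\<^sup>2 \<partial>\<mu>) =
    (\<integral>A. (cmod (f A))\<^sup>2 \<partial>\<mu>) - (\<Sum>S\<in>F. (cmod (L2_inner \<mu> S f))\<^sup>2)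
      + (\<Sum>S\<in>F. (cmod (c S - L2_inner \<mu> S f))\<^sup>2)"
proof -
  let ?p = "\<lambda>A. \<Sum>S\<in>F. c S * S A"
  let ?a = "\<lambda>S. L2_inner \<mu> S f"
  have S: "S \<in> L2 \<mu>" if "S \<in> F" for S using onb_L2 F that by blast
  have p: "?p \<in> L2 \<mu>" by (intro L2_sum L2_cmult S)
  have r: "(\<lambda>A. f A - ?p A) \<in> L2 \<mu>" by (rule L2_diff[OF f p])
  have inner_p: "L2_inner \<mu> h ?p = (\<Sum>S\<in>F. c S * L2_inner \<mu> h S)" if "h \<in> L2 \<mu>" for h
    using that by (subst L2_inner_sum_right) (simp_all add: L2_cmult S L2_inner_cmult_right)
  have onb: "L2_inner \<mu> S S' = (if S = S' then 1 else 0)" if "S \<in> F" "S' \<in> F" for S S'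
    using B F that unfolding L2_onb_def by blast
  have fp: "L2_inner \<mu> f ?p = (\<Sum>S\<in>F. c S * cnj (?a S))"
    by (simp add: inner_p[OF f] cnj_L2_inner)
  have pf: "L2_inner \<mu> ?p f = (\<Sum>S\<in>F. cnj (c S) * ?a S)"
    unfolding cnj_L2_inner[of \<mu> f ?p, symmetric] fp by simp
  have pS: "L2_inner \<mu> ?p S = cnj (c S)" if "S \<in> F" for S
  proof -
    have "L2_inner \<mu> S ?p = (\<Sum>S'\<in>F. if S' = S then c S' else 0)"
      unfolding inner_p[OF S[OF that]] by (intro sum.cong refl) (simp add: onb that)
    then have "L2_inner \<mu> S ?p = c S" using F that by simp
    then show ?thesis using cnj_L2_inner[of \<mu> S ?p] by simp
  qed
  have pp: "L2_inner \<mu> ?p ?p = (\<Sum>S\<in>F. c S * cnj (c S))"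
    by (simp add: inner_p[OF p] pS)
  have "L2_inner \<mu> (\<lambda>A. f A - ?p A) (\<lambda>A. f A - ?p A) =
      L2_inner \<mu> (\<lambda>A. f A - ?p A) f - L2_inner \<mu> (\<lambda>A. f A - ?p A) ?p"
    by (rule L2_inner_diff_right[OF r f p])
  also have "L2_inner \<mu> (\<lambda>A. f A - ?p A) f = cnj (L2_inner \<mu> f f - L2_inner \<mu> f ?p)"
    unfolding L2_inner_diff_right[OF f f p, symmetric] cnj_L2_inner ..
  also have "L2_inner \<mu> (\<lambda>A. f A - ?p A) ?p = cnj (L2_inner \<mu> ?p f - L2_inner \<mu> ?p ?p)"
    unfolding L2_inner_diff_right[OF p f p, symmetric] cnj_L2_inner ..
  also have "cnj (L2_inner \<mu> f f - L2_inner \<mu> f ?p) - cnj (L2_inner \<mu> ?p f - L2_inner \<mu> ?p ?p) =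
      L2_inner \<mu> f f - (\<Sum>S\<in>F. ?a S * cnj (?a S)) + (\<Sum>S\<in>F. (c S - ?a S) * cnj (c S - ?a S))"
    unfolding complex_cnj_diff cnj_L2_inner fp pf pp
    by (simp add: algebra_simps sum.distrib sum_subtractf cnj_L2_inner)
  finally have "complex_of_real (\<integral>A. (cmod (f A - ?p A))\<^sup>2 \<partial>\<mu>) =
     complex_of_real ((\<integral>A. (cmod (f A))\<^sup>2 \<partial>\<mu>) - (\<Sum>S\<in>F. (cmod (?a S))\<^sup>2)
      + (\<Sum>S\<in>F. (cmod (c S - ?a S))\<^sup>2))"
    unfolding L2_inner_self by (simp only: of_real_add of_real_diff of_real_sum complex_norm_square)
  then show ?thesis by (simp only: of_real_eq_iff)
qed

text \<open>Fourier coefficients in the distance formula give Bessel's inequality; an arbitrary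
  approximation from the density clause shows that the bound is approached. For nonnegative terms
  the supremum of the finite sums is the sum.\<close>

lemma has_sum_onb_norm:
  assumes f: "f \<in> L2 \<mu>"
  shows "((\<lambda>S. (cmod (L2_inner \<mu> S f))\<^sup>2) has_sum (\<integral>A. (cmod (f A))\<^sup>2 \<partial>\<mu>)) B"
proof -
  let ?a = "\<lambda>S. (cmod (L2_inner \<mu> S f))\<^sup>2" and ?n = "\<integral>A. (cmod (f A))\<^sup>2 \<partial>\<mu>"
  have bessel: "sum ?a F \<le> ?n" if "finite F" "F \<subseteq> B" for F
  proof -
    have "0 \<le> (\<integral>A. (cmod (f A - (\<Sum>S\<in>F. L2_inner \<mu> S f * S A)))\<^sup>2 \<partial>\<mu>)"
      by (intro integral_nonneg_AE) simp
    then show ?thesis by (simp add: L2_dist_onb[OF f that])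
  qed
  have approx: "\<exists>F. finite F \<and> F \<subseteq> B \<and> ?n - \<epsilon> < sum ?a F" if e0: "\<epsilon> > 0" for \<epsilon>
  proof -
    have D: "\<forall>f\<in>L2 \<mu>. \<forall>\<epsilon>>0. \<exists>F c. finite F \<and> F \<subseteq> B \<and>
        (\<integral>A. (cmod (f A - (\<Sum>S\<in>F. c S * S A)))\<^sup>2 \<partial>\<mu>) < \<epsilon>"
      using B by (simp add: L2_onb_def)
    obtain F c where F: "finite F" "F \<subseteq> B"
      and lt: "(\<integral>A. (cmod (f A - (\<Sum>S\<in>F. c S * S A)))\<^sup>2 \<partial>\<mu>) < \<epsilon>"
      using D[rule_format, OF f e0] by blast
    have "0 \<le> (\<Sum>S\<in>F. (cmod (c S - L2_inner \<mu> S f))\<^sup>2)" by (intro sum_nonneg) simp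
    then show ?thesis using lt F unfolding L2_dist_onb[OF f F] by (intro exI[of _ F]) simp
  qed
  have bdd: "bdd_above (sum ?a ` {F. F \<subseteq> B \<and> finite F})"
    using bessel by (intro bdd_aboveI[of _ ?n]) auto
  have "(SUP F\<in>{F. finite F \<and> F \<subseteq> B}. sum ?a F) = ?n"
  proof (rule cSup_eq_non_empty)
    show "sum ?a ` {F. finite F \<and> F \<subseteq> B} \<noteq> {}" by blast
    fix y assume y: "\<And>x. x \<in> sum ?a ` {F. finite F \<and> F \<subseteq> B} \<Longrightarrow> x \<le> y"
    show "?n \<le> y"
    proof (rule field_le_epsilon)
      fix \<epsilon> :: real assume "0 < \<epsilon>"
      from approx[OF this] obtain F where "finite F" "F \<subseteq> B" "?n - \<epsilon> < sum ?a F" by blast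
      then show "?n \<le> y + \<epsilon>" using y[of "sum ?a F"] by simp
    qed
  qed (use bessel in auto)
  then show ?thesis using nonneg_bdd_above_has_sum[OF _ bdd] by simp
qed

text \<open>Polarization of the norm identity, applied to \<open>f + c h\<close> for the four fourth
  roots of unity \<open>c\<close>.\<close>

lemma has_sum_onb_inner:
  assumes f: "f \<in> L2 \<mu>" and h: "h \<in> L2 \<mu>"
  shows "((\<lambda>S. L2_inner \<mu> f S * L2_inner \<mu> S h) has_sum L2_inner \<mu> f h) B"
proof -
  define q where "q u = complex_of_real (\<integral>A. (cmod (u A))\<^sup>2 \<partial>\<mu>)" for u
  have comb: "(\<lambda>A. f A + c * h A) \<in> L2 \<mu>" for c by (intro L2_add L2_cmult f h)
  have q: "((\<lambda>S. let z = L2_inner \<mu> S f + c * L2_inner \<mu> S h in z * cnj z) has_sum q (\<lambda>A. f A + c * h A)) B" for c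
  proof -
    have "((\<lambda>S. complex_of_real ((cmod (L2_inner \<mu> S (\<lambda>A. f A + c * h A)))\<^sup>2)) has_sum q (\<lambda>A. f A + c * h A)) B"
      unfolding q_def by (intro has_sum_of_real has_sum_onb_norm comb)
    moreover have "complex_of_real ((cmod (L2_inner \<mu> S (\<lambda>A. f A + c * h A)))\<^sup>2) =
        (let z = L2_inner \<mu> S f + c * L2_inner \<mu> S h in z * cnj z)" if "S \<in> B" for S
      unfolding complex_norm_square Let_def
      by (simp add: L2_inner_add_right L2_inner_cmult_right onb_L2 that f h L2_cmult)
    ultimately show ?thesis by (simp cong: has_sum_cong)
  qed
  \<comment> \<open>The polarization identity for complex numbers; the same four coefficients
    recover \<open>L2_inner \<mu> f h\<close> from the values of \<open>q\<close>.\<close>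
  have pol: "cnj u * v = (1/4) * ((u + 1 * v) * cnj (u + 1 * v)) + ((-1/4) * ((u + (-1) * v) * cnj (u + (-1) * v))
     + ((-\<i>/4) * ((u + \<i> * v) * cnj (u + \<i> * v)) + (\<i>/4) * ((u + (-\<i>) * v) * cnj (u + (-\<i>) * v))))" for u v
    by (simp add: field_simps)
  have exp: "q (\<lambda>A. f A + c * h A) =
      L2_inner \<mu> f f + c * L2_inner \<mu> f h + cnj c * L2_inner \<mu> h f + c * cnj c * L2_inner \<mu> h h" for c
  proof -
    have ch: "(\<lambda>A. c * h A) \<in> L2 \<mu>" by (rule L2_cmult[OF h])
    have "q (\<lambda>A. f A + c * h A) = L2_inner \<mu> (\<lambda>A. f A + c * h A) (\<lambda>A. f A + c * h A)"
      by (simp add: q_def L2_inner_self)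
    also have "\<dots> = L2_inner \<mu> (\<lambda>A. f A + c * h A) f + c * L2_inner \<mu> (\<lambda>A. f A + c * h A) h"
      by (simp add: L2_inner_add_right[OF comb f ch] L2_inner_cmult_right)
    also have "L2_inner \<mu> (\<lambda>A. f A + c * h A) f = cnj (L2_inner \<mu> f f + c * L2_inner \<mu> f h)"
      by (subst cnj_L2_inner[symmetric]) (simp add: L2_inner_add_right[OF f f ch] L2_inner_cmult_right)
    also have "L2_inner \<mu> (\<lambda>A. f A + c * h A) h = cnj (L2_inner \<mu> h f + c * L2_inner \<mu> h h)"
      by (subst cnj_L2_inner[symmetric]) (simp add: L2_inner_add_right[OF h f ch] L2_inner_cmult_right)
    finally show ?thesis by (simp add: cnj_L2_inner algebra_simps)
  qed
  have "((\<lambda>S. cnj (L2_inner \<mu> S f) * L2_inner \<mu> S h) has_sum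
     ((1/4) * q (\<lambda>A. f A + 1 * h A) + ((-1/4) * q (\<lambda>A. f A + (-1) * h A)
      + ((-\<i>/4) * q (\<lambda>A. f A + \<i> * h A) + (\<i>/4) * q (\<lambda>A. f A + (-\<i>) * h A))))) B"
    unfolding pol by (intro has_sum_add has_sum_cmult_right q[unfolded Let_def])
  also have "(1/4) * q (\<lambda>A. f A + 1 * h A) + ((-1/4) * q (\<lambda>A. f A + (-1) * h A)
      + ((-\<i>/4) * q (\<lambda>A. f A + \<i> * h A) + (\<i>/4) * q (\<lambda>A. f A + (-\<i>) * h A))) = L2_inner \<mu> f h"
    unfolding exp by (simp add: field_simps)
  finally show ?thesis by (simp add: cnj_L2_inner)
qed

end

section \<open>The reduced density matrix\<close>

text \<open>The factor \<open>\<i>\<close> makes the determinant 1 while the phases of the two spins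
  still differ by a sign.\<close>

definition phase_mat :: "complex^2^2" where
  "phase_mat = (\<chi> i j. if i = j then if i = 1 then \<i> else - \<i> else 0)"

text \<open>Exchanges the two spins up to sign; the minus sign makes the determinant 1.\<close>

definition flip_mat :: "complex^2^2" where
  "flip_mat = (\<chi> i j. if i = j then 0 else if i = 1 then 1 else -1)"

lemma phase_mat_SU2: "phase_mat \<in> SU2"
  by (simp add: SU2_def phase_mat_def det_2 adj_def vec_eq_iff forall_2 matrix_matrix_mult_def sum_2 mat_def)

lemma flip_mat_SU2: "flip_mat \<in> SU2"
  by (simp add: SU2_def flip_mat_def det_2 adj_def vec_eq_iff forall_2 matrix_matrix_mult_def sum_2 mat_def)

lemma prod_list_unimodular:
  fixes f :: "'b \<Rightarrow> complex"
  assumes "\<And>a. f a * cnj (f a) = 1"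
  shows "prod_list (map f l) * cnj (prod_list (map f l)) = 1"
proof (induction l)
  case (Cons a l)
  have "prod_list (map f (a # l)) * cnj (prod_list (map f (a # l))) =
      (f a * cnj (f a)) * (prod_list (map f l) * cnj (prod_list (map f l)))"
    by (simp add: mult_ac)
  then show ?case unfolding Cons.IH assms by simp
qed simp

lemma has_sum_finite_sum:
  fixes f :: "'i \<Rightarrow> 'b \<Rightarrow> 'c::topological_comm_monoid_add"
  assumes "\<And>i. i \<in> I \<Longrightarrow> (f i has_sum s i) A"
  shows "((\<lambda>x. \<Sum>i\<in>I. f i x) has_sum (\<Sum>i\<in>I. s i)) A"
  using assms by (induction I rule: infinite_finite_induct) (auto intro!: has_sum_add)

section \<open>Matrix elements of the reduced state\<close>

text \<open>\<open>m\<close> occupies the antilinear slot because it comes from the bra;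
  \<open>Phi_kernel\<close> follows the same convention.\<close>

definition state_kernel :: "'p conn measure \<Rightarrow> 'p state \<Rightarrow> 'p config \<Rightarrow> 'p config \<Rightarrow> complex" where
  "state_kernel \<mu> \<Psi> l m = L2_inner \<mu> (\<lambda>A. \<Psi> A m) (\<lambda>A. \<Psi> A l)"

lemma Htot_L2: "\<Psi> \<in> Htot \<mu> \<Longrightarrow> (\<lambda>A. \<Psi> A l) \<in> L2 \<mu>"
  by (simp add: Htot_def)

lemma L2_measurable: "f \<in> L2 \<mu> \<Longrightarrow> f \<in> borel_measurable \<mu>"
  by (simp add: L2_def)

lemma cnj_state_kernel: "cnj (state_kernel \<mu> \<Psi> l m) = state_kernel \<mu> \<Psi> m l"
  by (simp add: state_kernel_def cnj_L2_inner)

lemma antisymmetric_state_kernel_left: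
  assumes "\<Psi> \<in> Htot \<mu>"
  shows "antisymmetric (\<lambda>l. state_kernel \<mu> \<Psi> l m)"
proof (rule antisymmetric_if_swap_list)
  fix l :: "'a config" and i j assume ij: "i < j" "j < length l"
  note meas = L2_measurable[OF Htot_L2[OF assms]]
  have "AE A in \<mu>. \<Psi> A (swap_list l i j) = (-1) * \<Psi> A l"
    using assms ij by (simp add: Htot_def)
  then have "state_kernel \<mu> \<Psi> (swap_list l i j) m = L2_inner \<mu> (\<lambda>A. \<Psi> A m) (\<lambda>A. (-1) * \<Psi> A l)"
    unfolding state_kernel_def
    by (intro L2_inner_cong_AE meas) (auto intro!: borel_measurable_times meas)
  then show "state_kernel \<mu> \<Psi> (swap_list l i j) m = - state_kernel \<mu> \<Psi> l m"
    unfolding L2_inner_cmult_right by (simp add: state_kernel_def)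
qed

lemma antisymmetric_state_kernel_right:
  assumes "\<Psi> \<in> Htot \<mu>"
  shows "antisymmetric (state_kernel \<mu> \<Psi> l)"
proof -
  have "state_kernel \<mu> \<Psi> l = (\<lambda>m. cnj (state_kernel \<mu> \<Psi> m l))"
    by (simp add: cnj_state_kernel)
  then show ?thesis
    using antisymmetric_state_kernel_left[OF assms, of l]
    unfolding antisymmetric_def by (metis complex_cnj_minus)
qed

lemma fermions_at_eq_0:
  assumes \<Psi>: "\<Psi> \<in> fermions_at \<mu> xs" and "\<And>As. length As = length xs \<Longrightarrow> Phi xs As l = 0"
  shows "AE A in \<mu>. \<Psi> A l = 0"
proof -
  obtain f where "Htot_eq \<mu> \<Psi> (\<lambda>A l. \<Sum>As\<in>{As. length As = length xs}. tensor (f As) (Phi xs As) A l)"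
    using \<Psi> unfolding fermions_at_def by blast
  then have "AE A in \<mu>. \<Psi> A l = (\<Sum>As\<in>{As. length As = length xs}. f As A * Phi xs As l)"
    by (simp add: Htot_eq_def tensor_def)
  moreover have "(\<Sum>As\<in>{As. length As = length xs}. f As A * Phi xs As l) = 0" for A
    using assms(2) by (intro sum.neutral) simp
  ultimately show ?thesis by (simp only:)
qed

lemma L2_inner_eq_0_AE:
  assumes "AE A in \<mu>. f A = 0"
  shows "L2_inner \<mu> f h = 0"
  unfolding L2_inner_def by (rule integral_eq_zero_AE) (use assms in \<open>eventually_elim, simp\<close>)

lemma state_kernel_nonzero:
  assumes \<Psi>: "\<Psi> \<in> fermions_at \<mu> xs" and "state_kernel \<mu> \<Psi> l m \<noteq> 0"
  shows "mset (map fst m) = mset xs" "mset (map fst l) = mset xs"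
proof -
  have *: "mset (map fst m) = mset xs" if "state_kernel \<mu> \<Psi> l m \<noteq> 0" for l m
  proof (rule ccontr)
    assume "mset (map fst m) \<noteq> mset xs"
    then have "Phi xs As m = 0" if "length As = length xs" for As
      using Phi_nonzero[OF that] mset_map_fst_zip[OF that] by blast
    then show False
      using that L2_inner_eq_0_AE[OF fermions_at_eq_0[OF \<Psi>]] unfolding state_kernel_def by blast
  qed
  show "mset (map fst m) = mset xs" using *[OF assms(2)] .
  show "mset (map fst l) = mset xs"
    using *[of m l] assms(2) by (simp flip: cnj_state_kernel[of _ _ l m])
qed

text \<open>Makes the sums over configurations in the inner products finite, so that they can be
  exchanged with the sum over the basis.\<close>

lemma finite_admissible: "finite {l :: 'p config. mset (map fst l) = mset xs}"
proof (rule finite_subset)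
  show "{l :: 'p config. mset (map fst l) = mset xs} \<subseteq>
      {l. set l \<subseteq> set xs \<times> UNIV \<and> length l = length xs}"
  proof
    fix l :: "'p config" assume "l \<in> {l. mset (map fst l) = mset xs}"
    then have eq: "mset (map fst l) = mset xs" by simp
    have "set (map fst l) = set xs" using mset_eq_setD[OF eq] .
    moreover have "length l = length xs" using mset_eq_length[OF eq] by simp
    ultimately show "l \<in> {l. set l \<subseteq> set xs \<times> UNIV \<and> length l = length xs}" by force
  qed
  show "finite {l. set l \<subseteq> set xs \<times> (UNIV :: 2 set) \<and> length l = length xs}"
    by (intro finite_lists_length_eq) simp
qed

section \<open>Consequences of gauge invariance\<close>

context
  fixes \<A> :: "'p::topological_space atlas" and \<eta> \<mu> and \<Psi> :: "'p state" and xs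
  assumes \<eta>: "is_haar_SU2 \<eta>" and \<mu>: "is_AL_measure \<A> \<eta> \<mu>"
    and \<Psi>: "\<Psi> \<in> fermions_at \<mu> xs" and inv: "gauge_invariant \<A> \<mu> \<Psi>"
begin

lemma state_Htot: "\<Psi> \<in> Htot \<mu>"
  using \<Psi> by (simp add: fermions_at_def)

text \<open>Gauge invariance replaces \<Psi> by its transform in both slots. The Fock part
  contributes the weights \<open>w\<close> and the relabelling \<open>q\<close>; the effect on
  connections is undone by invariance of the measure.\<close>

lemma state_kernel_gauge:
  assumes g: "gauge_transf g" and p: "\<And>x A C. C \<noteq> p x A \<Longrightarrow> g x $ C $ A = 0"
  defines "w \<equiv> \<lambda>l. prod_list (map (\<lambda>(x, A). cnj (g x $ p x A $ A)) l)"
    and "q \<equiv> map (\<lambda>(x, A). (x, p x A))"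
  shows "state_kernel \<mu> \<Psi> l m = w l * cnj (w m) * state_kernel \<mu> \<Psi> (q l) (q m)"
proof -
  let ?G = "gauge_conn \<A> g"
  note meas = L2_measurable[OF Htot_L2[OF state_Htot]]
  have G: "?G \<in> measurable \<mu> \<mu>"
    using measurable_gauge_conn \<eta> \<mu> g unfolding is_AL_measure_def by blast
  have ae: "AE A in \<mu>. \<Psi> A l = w l * \<Psi> (?G A) (q l)" for l
  proof -
    have "AE A in \<mu>. gauge_Fock g (\<Psi> (?G A)) l = \<Psi> A l"
      using inv g unfolding gauge_invariant_def Htot_eq_def gauge_tot_def by blast
    moreover have "gauge_Fock g \<phi> l = w l * \<phi> (q l)" for \<phi>
      unfolding w_def q_def by (rule gauge_Fock_monomial[OF p])
    ultimately show ?thesis by (simp only: eq_commute)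
  qed
  have m': "(\<lambda>A. w l * \<Psi> (?G A) (q l)) \<in> borel_measurable \<mu>" for l
    by (rule borel_measurable_times[OF borel_measurable_const measurable_compose[OF G meas]])
  have "state_kernel \<mu> \<Psi> l m =
      L2_inner \<mu> (\<lambda>A. w m * \<Psi> (?G A) (q m)) (\<lambda>A. w l * \<Psi> (?G A) (q l))"
    unfolding state_kernel_def by (intro L2_inner_cong_AE meas m' ae)
  also have "\<dots> = (\<integral>A. (w l * cnj (w m)) * (cnj (\<Psi> (?G A) (q m)) * \<Psi> (?G A) (q l)) \<partial>\<mu>)"
    unfolding L2_inner_def by (simp add: mult_ac)
  also have "\<dots> = (w l * cnj (w m)) * (\<integral>A. cnj (\<Psi> (?G A) (q m)) * \<Psi> (?G A) (q l) \<partial>\<mu>)"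
    by (rule integral_mult_right_zero)
  \<comment> \<open>Change of variables along the gauge transformation of connections.\<close>
  also have "(\<integral>A. cnj (\<Psi> (?G A) (q m)) * \<Psi> (?G A) (q l) \<partial>\<mu>) =
      (\<integral>A. cnj (\<Psi> A (q m)) * \<Psi> A (q l) \<partial>(distr \<mu> \<mu> ?G))"
    by (rule integral_distr[OF G, symmetric])
      (intro borel_measurable_integrable L2_mult_integrable Htot_L2 state_Htot)
  also have "distr \<mu> \<mu> ?G = \<mu>" by (rule distr_gauge_conn[OF \<eta> \<mu> g])
  finally show ?thesis unfolding state_kernel_def L2_inner_def .
qed

lemma state_kernel_offdiag:
  assumes l: "distinct l" and m: "distinct m" and eq: "mset (map fst l) = mset (map fst m)"
    and ne: "mset l \<noteq> mset m"
  shows "state_kernel \<mu> \<Psi> l m = 0"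
proof -
  have "length l = length m" using eq by (metis length_map size_mset)
  then have "card (set l) = card (set m)" using l m by (simp add: distinct_card)
  moreover have "set l \<noteq> set m" using ne l m set_eq_iff_mset_eq_distinct by blast
  ultimately have "\<not> set l \<subseteq> set m" using card_subset_eq by blast
  then obtain x A where A: "(x, A) \<in> set l" "(x, A) \<notin> set m" by auto
  \<comment> \<open>The phase acts only at a point where the configurations differ, and there each
    of them has exactly one fermion.\<close>
  define g where "g y = (if y = x then phase_mat else mat 1)" for y
  have g: "gauge_transf g"
    by (auto simp: gauge_transf_def g_def phase_mat_SU2 mat_1_SU2)
  have p: "g y $ C $ A = 0" if "C \<noteq> A" for y C A
    using that by (simp add: g_def phase_mat_def mat_def)
  have w: "prod_list (map (\<lambda>(y, A). cnj (g y $ A $ A)) l) = cnj (phase_mat $ C $ C)"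
    if "distinct l" "{a \<in> set l. fst a = x} = {(x, C)}" for l C
  proof -
    have "prod_list (map (\<lambda>(y, A). cnj (g y $ A $ A)) l) =
        (\<Prod>a\<in>set l. if fst a = x then cnj (phase_mat $ snd a $ snd a) else 1)"
      unfolding prod.distinct_set_conv_list[OF that(1), symmetric]
      by (intro prod.cong) (auto simp: g_def mat_def)
    also have "\<dots> = (\<Prod>a\<in>{a \<in> set l. fst a = x}. cnj (phase_mat $ snd a $ snd a))"
      by (rule prod.inter_filter[symmetric]) simp
    finally show ?thesis unfolding that(2) by simp
  qed
  note pos = same_positions_cases[OF l m eq A]
  \<comment> \<open>The two fermions at \<open>x\<close> have opposite spins, so the combined phase
    is -1 and the matrix element is its own negative.\<close>
  have "state_kernel \<mu> \<Psi> l m = cnj (phase_mat $ A $ A) *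
      cnj (cnj (phase_mat $ spin_flip A $ spin_flip A)) * state_kernel \<mu> \<Psi> l m"
    using state_kernel_gauge[OF g p, of "\<lambda>x A. A" l m]
    by (simp add: w[OF l pos(1)] w[OF m pos(2)])
  then have "state_kernel \<mu> \<Psi> l m = - state_kernel \<mu> \<Psi> l m"
    using exhaust_2[of A] by (auto simp: phase_mat_def spin_flip_def)
  then show ?thesis by simp
qed

text \<open>Rotating by \<open>flip_mat\<close> at the points of \<open>X\<close> flips both
  arguments. As they are equal, the weight meets its own conjugate and the signs drop out.\<close>

lemma state_kernel_flip:
  "state_kernel \<mu> \<Psi> (map (flip_at X) l) (map (flip_at X) l) = state_kernel \<mu> \<Psi> l l"
proof -
  define g where "g y = (if y \<in> X then flip_mat else mat 1)" for y
  define p where "p y A = (if y \<in> X then spin_flip A else A)" for y A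
  have g: "gauge_transf g"
    by (auto simp: gauge_transf_def g_def flip_mat_SU2 mat_1_SU2)
  have p: "g y $ C $ A = 0" if "C \<noteq> p y A" for y C A
    using that exhaust_2[of A] exhaust_2[of C]
    by (auto simp: g_def p_def flip_mat_def mat_def spin_flip_def split: if_splits)
  have flip: "(\<lambda>(x, A). (x, p x A)) = flip_at X"
    by (simp add: fun_eq_iff flip_at_def p_def)
  let ?w = "\<lambda>l. prod_list (map (\<lambda>(x, A). cnj (g x $ p x A $ A)) l)"
  have "(case a of (x, A) \<Rightarrow> cnj (g x $ p x A $ A)) * cnj (case a of (x, A) \<Rightarrow> cnj (g x $ p x A $ A)) = 1" for a
    using exhaust_2[of "snd a"]
    by (auto simp: g_def p_def flip_mat_def mat_def spin_flip_def split: prod.splits)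
  then have "?w l * cnj (?w l) = 1" for l
    by (rule prod_list_unimodular)
  then show ?thesis
    using state_kernel_gauge[where p=p, OF g p, of l l] by (simp add: flip)
qed

lemma spin_kernel_state_kernel: "spin_kernel xs (state_kernel \<mu> \<Psi>)"
  unfolding spin_kernel_def
proof (intro conjI allI impI)
  fix l m
  show "antisymmetric (\<lambda>l. state_kernel \<mu> \<Psi> l m)" "antisymmetric (state_kernel \<mu> \<Psi> l)"
    by (intro antisymmetric_state_kernel_left antisymmetric_state_kernel_right state_Htot)+
  assume nz: "state_kernel \<mu> \<Psi> l m \<noteq> 0"
  show "mset (map fst l) = mset xs" using state_kernel_nonzero[OF \<Psi> nz] by simp
  \<comment> \<open>Where the kernel is nonzero, Pauli exclusion supplies the distinctness that
    \<open>state_kernel_offdiag\<close> asks for.\<close>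
  have "distinct l" "distinct m"
    using nz antisymmetric_not_distinct[OF antisymmetric_state_kernel_left[OF state_Htot]]
      antisymmetric_not_distinct[OF antisymmetric_state_kernel_right[OF state_Htot]] by blast+
  moreover have "mset (map fst l) = mset (map fst m)"
    using state_kernel_nonzero[OF \<Psi> nz] by simp
  ultimately show "mset l = mset m" using state_kernel_offdiag nz by blast
qed (rule state_kernel_flip)

text \<open>Both kernels are multiples of their diagonal value at one reference configuration
  \<open>k\<close>, with a common factor. These diagonal values are sums or integrals of squared
  moduli, so their ratio \<open>C\<close> is real.\<close>

lemma state_kernel_proportional:
  "\<exists>C::real. \<forall>l m. state_kernel \<mu> \<Psi> l m = complex_of_real C * Phi_kernel xs l m"
proof -
  obtain k where k: "\<And>l m. \<exists>\<kappa>. \<forall>K. spin_kernel xs K \<longrightarrow> K l m = \<kappa> * K k k"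
    using spin_kernel_unique by blast
  define a where "a = (\<integral>A. (cmod (\<Psi> A k))\<^sup>2 \<partial>\<mu>)"
  define b where "b = (\<Sum>As | length As = length xs. (cmod (Phi xs As k))\<^sup>2)"
  have Ka: "state_kernel \<mu> \<Psi> k k = complex_of_real a"
    by (simp add: state_kernel_def L2_inner_self a_def)
  have Nb: "Phi_kernel xs k k = complex_of_real b"
    by (simp only: Phi_kernel_diag b_def)
  \<comment> \<open>If every \<Phi> vanishes at \<open>k\<close>, so does the state; this covers the
    degenerate case, where \<open>a / b\<close> is 0 by convention.\<close>
  have zero: "a = 0" if "b = 0"
  proof -
    have "Phi xs As k = 0" if "length As = length xs" for As
      using \<open>b = 0\<close> that unfolding b_def
      by (subst (asm) sum_nonneg_eq_0_iff) (auto simp: finite_lists_length)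
    then have "state_kernel \<mu> \<Psi> k k = 0"
      unfolding state_kernel_def by (intro L2_inner_eq_0_AE fermions_at_eq_0[OF \<Psi>])
    then show ?thesis by (simp add: Ka)
  qed
  have "state_kernel \<mu> \<Psi> l m = complex_of_real (a / b) * Phi_kernel xs l m" for l m
  proof -
    obtain \<kappa> where "\<And>K. spin_kernel xs K \<Longrightarrow> K l m = \<kappa> * K k k" using k by blast
    from this[OF spin_kernel_state_kernel] this[OF spin_kernel_Phi_kernel]
    have "state_kernel \<mu> \<Psi> l m = \<kappa> * complex_of_real a" "Phi_kernel xs l m = \<kappa> * complex_of_real b"
      by (simp_all only: Ka Nb)
    then show ?thesis using zero by (cases "b = 0") simp_all
  qed
  then show ?thesis by blast
qed

section \<open>The partial trace and the sum over \<Phi> as kernel operators\<close>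

text \<open>Only finitely many configurations \<open>m\<close> contribute, so the sum over the basis
  is taken inside, where Parseval's identity evaluates it for each \<open>m\<close>. The choice of
  basis thereby disappears.\<close>

lemma tr_G_ketbra:
  assumes B: "L2_onb \<mu> B"
  shows "tr_G \<mu> B (ketbra_tot \<mu> \<Psi>) \<phi> l =
    (\<Sum>m | mset (map fst m) = mset xs. \<phi> m * state_kernel \<mu> \<Psi> l m)"
proof -
  let ?\<Psi> = "\<lambda>l A. \<Psi> A l" and ?L = "{m. mset (map fst m) = mset xs}"
  have zero: "L2_inner \<mu> (?\<Psi> m) S = 0" if "m \<notin> ?L" for m S
  proof -
    have "Phi xs As m = 0" if "length As = length xs" for As
      using Phi_nonzero[OF that] mset_map_fst_zip[OF that] \<open>m \<notin> ?L\<close> by blast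
    then show ?thesis by (intro L2_inner_eq_0_AE fermions_at_eq_0[OF \<Psi>])
  qed
  have "Htot_inner \<mu> \<Psi> (tensor S \<phi>) = (\<Sum>m\<in>?L. \<phi> m * L2_inner \<mu> (?\<Psi> m) S)" for S
  proof -
    have "Htot_inner \<mu> \<Psi> (tensor S \<phi>) = (\<Sum>\<^sub>\<infinity>m. \<phi> m * L2_inner \<mu> (?\<Psi> m) S)"
      unfolding Htot_inner_def tensor_def mult.commute[of "S _"] L2_inner_cmult_right ..
    also have "\<dots> = (\<Sum>\<^sub>\<infinity>m\<in>?L. \<phi> m * L2_inner \<mu> (?\<Psi> m) S)"
      by (rule infsum_cong_neutral) (simp_all add: zero)
    finally show ?thesis by (simp only: infsum_finite[OF finite_admissible])
  qed
  then have bra: "braS \<mu> S (ketbra_tot \<mu> \<Psi> (tensor S \<phi>)) l =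
      (\<Sum>m\<in>?L. \<phi> m * (L2_inner \<mu> (?\<Psi> m) S * L2_inner \<mu> S (?\<Psi> l)))" for S
    unfolding braS_def ketbra_tot_def mult.commute[of "\<Psi> _ _"] L2_inner_cmult_right
    by (simp add: sum_distrib_right mult.assoc)
  have "((\<lambda>S. \<Sum>m\<in>?L. \<phi> m * (L2_inner \<mu> (?\<Psi> m) S * L2_inner \<mu> S (?\<Psi> l))) has_sum
      (\<Sum>m\<in>?L. \<phi> m * L2_inner \<mu> (?\<Psi> m) (?\<Psi> l))) B"
    by (intro has_sum_finite_sum has_sum_cmult_right has_sum_onb_inner[OF B] Htot_L2 state_Htot)
  then show ?thesis unfolding tr_G_def bra state_kernel_def by (rule infsumI)
qed

end

lemma sum_ketbra_Phi:
  "(\<Sum>As\<in>{As. length As = length xs}. ketbra_Fock (Phi xs As) \<phi> l) =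
    (\<Sum>m | mset (map fst m) = mset xs. \<phi> m * Phi_kernel xs l m)"
proof -
  let ?L = "{m. mset (map fst m) = mset xs}"
  have "Fock_inner (Phi xs As) \<phi> = (\<Sum>m\<in>?L. cnj (Phi xs As m) * \<phi> m)" if "length As = length xs" for As
  proof -
    have "Phi xs As m = 0" if "m \<notin> ?L" for m
      using Phi_nonzero mset_map_fst_zip \<open>length As = length xs\<close> that by blast
    then have "Fock_inner (Phi xs As) \<phi> = (\<Sum>\<^sub>\<infinity>m\<in>?L. cnj (Phi xs As m) * \<phi> m)"
      unfolding Fock_inner_def by (intro infsum_cong_neutral) auto
    then show ?thesis by (simp only: infsum_finite[OF finite_admissible])
  qed
  then have "(\<Sum>As\<in>{As. length As = length xs}. ketbra_Fock (Phi xs As) \<phi> l) =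
      (\<Sum>As\<in>{As. length As = length xs}. \<Sum>m\<in>?L. \<phi> m * (Phi xs As l * cnj (Phi xs As m)))"
    unfolding ketbra_Fock_def sum_distrib_left[symmetric]
    by (intro sum.cong refl) (simp add: sum_distrib_left mult_ac)
  also have "\<dots> = (\<Sum>m\<in>?L. \<phi> m * Phi_kernel xs l m)"
    unfolding Phi_kernel_def sum_distrib_left by (rule sum.swap)
  finally show ?thesis .
qed

theorem proposition2p2:
  fixes \<A> :: "'p::{t2_space,second_countable_topology} atlas"
    and \<eta> :: "(complex^2^2) measure"
    and \<mu> :: "'p conn measure"
    and B :: "('p conn \<Rightarrow> complex) set"
    and xs :: "'p list"
    and \<Psi> :: "'p state"
  assumes "analytic_atlas \<A>"
    and "is_haar_SU2 \<eta>"
    and "is_AL_measure \<A> \<eta> \<mu>"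
    and "L2_onb \<mu> B"
    and "\<Psi> \<in> fermions_at \<mu> xs"
    and "gauge_invariant \<A> \<mu> \<Psi>"
  shows "\<exists>C::real. \<forall>\<phi>\<in>Fock.
           tr_G \<mu> B (ketbra_tot \<mu> \<Psi>) \<phi> =
             (\<lambda>l. complex_of_real C *
                (\<Sum>As\<in>{As. length As = length xs}. ketbra_Fock (Phi xs As) \<phi> l))"
proof -
  obtain C where C: "\<And>l m. state_kernel \<mu> \<Psi> l m = complex_of_real C * Phi_kernel xs l m"
    using state_kernel_proportional[OF assms(2,3,5,6)] by blast
  \<comment> \<open>Both operators act through their kernels over the same finite set of
    configurations, so proportionality passes from the kernels to the operators.\<close>
  have "tr_G \<mu> B (ketbra_tot \<mu> \<Psi>) \<phi> l =
      complex_of_real C * (\<Sum>As\<in>{As. length As = length xs}. ketbra_Fock (Phi xs As) \<phi> l)" for \<phi> l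
    unfolding tr_G_ketbra[OF assms(2,3,5,6,4)] sum_ketbra_Phi C sum_distrib_left
    by (simp only: mult.left_commute)
  then show ?thesis by (intro exI[of _ C] ballI ext)
qed

end
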